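(* Let $K$ be a field, let $n\ge 2$ be an integer, let $S=K[x_1,\ldots,x_n]$, and let $I_3(P_n^2)\subseteq S$ be the 3-path ideal of the square $P_n^2$ of the path on $n$ vertices. Then the ring $S/I_3(P_n^2)$ is Cohen-Macaulay if and only if $n=3$ or $n=4$.
   Context: For $n\ge 2$, $P_n^2$ (the square of the path $P_n$ on the vertices $1,\ldots,n$) is the simple graph on the vertex set $\{1,\ldots,n\}$ in which, for $1\le i<j\le n$, $\{i,j\}$ is an edge if and only if $0<j-i\le 2$. For a finite simple graph $G$ on $\{1,\ldots,n\}$, the 3-path ideal $I_3(G)\subseteq S=K[x_1,\ldots,x_n]$ is the ideal generated by all monomials $x_ax_bx_c$ such that $a,b,c$ are distinct vertices forming a path with 3 vertices in $G$ (i.e. $\{a,b\}$ and $\{b,c\}$ are edges of $G$). Explicitly, $I_3(P_n^2)$ is generated by all monomials of the forms $x_ix_{i+1}x_{i+2}$, $x_ix_{i+1}x_{i+3}$, $x_ix_{i+2}x_{i+3}$, $x_ix_{i+2}x_{i+4}$ ($i\ge 1$) all of whose indices are at most $n$. $S/I_3(P_n^2)$ being Cohen-Macaulay means that its depth with respect to the graded maximal ideal $(x_1,\ldots,x_n)$ equals its Krull dimension.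
   Formalization: The formal theorem assumes n ≥ 3 instead of n ≥ 2: for n = 2 the 3-path ideal is zero and S/I = K[x_1,x_2] is Cohen-Macaulay, so the stated equivalence fails there. *)

theory Defs
  imports
    "HOL-Library.Poly_Mapping"
    "HOL-Library.Extended_Nat"
    "HOL-Algebra.QuotRing"
begin

section \<open>The polynomial ring in the variables $x_1, \ldots, x_n$\<close>

text \<open>
  A monomial is an exponent vector of type \<^typ>\<open>nat \<Rightarrow>\<^sub>0 nat\<close>; the type below contains polynomials
  in all variables $x_0, x_1, x_2, \ldots$, and the carrier of \<open>poly_ring n\<close> cuts out those
  that involve only $x_1, \ldots, x_n$.
\<close>

type_synonym 'k mpoly = "(nat \<Rightarrow>\<^sub>0 nat) \<Rightarrow>\<^sub>0 'k"

definition X :: "nat \<Rightarrow> 'k::comm_ring_1 mpoly" where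
  "X i = Poly_Mapping.single (Poly_Mapping.single i 1) 1"

definition poly_ring :: "nat \<Rightarrow> 'k::comm_ring_1 mpoly ring" where
  "poly_ring n =
     \<lparr>carrier = {p. \<forall>m \<in> Poly_Mapping.keys p. Poly_Mapping.keys m \<subseteq> {1..n}},
      mult = (*), one = 1, zero = 0, add = (+)\<rparr>"

lemma X_in_carrier: "i \<in> {1..n} \<Longrightarrow> X i \<in> carrier (poly_ring n)"
  by (simp add: X_def poly_ring_def)

lemma poly_ring_cring: "cring (poly_ring n :: 'k::comm_ring_1 mpoly ring)"
proof -
  let ?S = "poly_ring n :: 'k mpoly ring"
  have add: "p + q \<in> carrier ?S" if "p \<in> carrier ?S" "q \<in> carrier ?S" for p q
    using that Poly_Mapping.keys_add[of p q] by (auto simp: poly_ring_def)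
  have mult: "p * q \<in> carrier ?S" if pq: "p \<in> carrier ?S" "q \<in> carrier ?S" for p q
  proof -
    have "Poly_Mapping.keys m \<subseteq> {1..n}" if m: "m \<in> Poly_Mapping.keys (p * q)" for m
    proof -
      obtain a b where ab: "m = a + b" "a \<in> Poly_Mapping.keys p" "b \<in> Poly_Mapping.keys q"
        using subsetD[OF Poly_Mapping.keys_mult m] by auto
      then have "Poly_Mapping.keys a \<subseteq> {1..n}" "Poly_Mapping.keys b \<subseteq> {1..n}"
        using pq unfolding poly_ring_def by simp_all
      then show ?thesis
        unfolding ab(1) using Poly_Mapping.keys_add[of a b] by (meson Un_least order_trans)
    qed
    then show ?thesis by (simp add: poly_ring_def)
  qed
  have neg: "- p \<in> carrier ?S" if "p \<in> carrier ?S" for p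
    using that by (simp add: poly_ring_def in_keys_iff)
  have ops: "(\<otimes>\<^bsub>?S\<^esub>) = (*)" "(\<oplus>\<^bsub>?S\<^esub>) = (+)" "\<one>\<^bsub>?S\<^esub> = 1" "\<zero>\<^bsub>?S\<^esub> = 0"
    by (simp_all add: poly_ring_def)
  have zero_one: "0 \<in> carrier ?S" "1 \<in> carrier ?S"
    by (simp_all add: poly_ring_def)
  have "abelian_group ?S"
  proof (rule abelian_groupI)
    fix p assume "p \<in> carrier ?S"
    then show "\<exists>q\<in>carrier ?S. q \<oplus>\<^bsub>?S\<^esub> p = \<zero>\<^bsub>?S\<^esub>"
      using neg by (intro bexI[of _ "- p"]) (simp_all add: ops)
  qed (simp_all add: ops zero_one add add.assoc add.commute)
  moreover have "Group.comm_monoid ?S"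
    by (rule comm_monoidI) (simp_all add: ops zero_one mult mult.assoc mult.commute)
  ultimately show ?thesis
    by (rule cringI) (simp add: ops distrib_right)
qed

definition irrelevant_ideal :: "nat \<Rightarrow> 'k::comm_ring_1 mpoly set" where
  "irrelevant_ideal n = Idl\<^bsub>poly_ring n\<^esub> (X ` {1..n})"


section \<open>The 3-path ideal of the square of a path\<close>

text \<open>A graph on the vertex set $\{1, \ldots, n\}$ is given by its set of edges.\<close>

definition path_square :: "nat \<Rightarrow> nat set set" where
  "path_square n = {{i, j} | i j. 1 \<le> i \<and> i < j \<and> j \<le> n \<and> j - i \<le> 2}"

definition path3_ideal :: "nat \<Rightarrow> nat set set \<Rightarrow> 'k::comm_ring_1 mpoly set" where
  "path3_ideal n E = Idl\<^bsub>poly_ring n\<^esub> {X a * X b * X c | a b c.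
     a \<in> {1..n} \<and> b \<in> {1..n} \<and> c \<in> {1..n} \<and> a \<noteq> b \<and> b \<noteq> c \<and> a \<noteq> c \<and> {a, b} \<in> E \<and> {b, c} \<in> E}"

text \<open>
  The square of the path on two vertices has no path with three vertices: its 3-path ideal is
  zero, and the quotient is the polynomial ring in two variables itself.
\<close>

lemma path3_ideal_two: "path3_ideal 2 E = ({0} :: 'k::comm_ring_1 mpoly set)"
proof -
  interpret cring "poly_ring 2 :: 'k mpoly ring" by (rule poly_ring_cring)
  have "path3_ideal 2 E = Idl\<^bsub>poly_ring 2\<^esub> ({} :: 'k mpoly set)"
    unfolding path3_ideal_def by (rule arg_cong[where f = "genideal (poly_ring 2)"]) auto
  also have "\<dots> = {\<zero>\<^bsub>poly_ring 2\<^esub>}"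
  proof
    show "Idl\<^bsub>poly_ring 2\<^esub> {} \<subseteq> {\<zero>\<^bsub>poly_ring 2\<^esub> :: 'k mpoly}"
      by (rule genideal_minimal[OF zeroideal]) simp
    show "{\<zero>\<^bsub>poly_ring 2\<^esub> :: 'k mpoly} \<subseteq> Idl\<^bsub>poly_ring 2\<^esub> {}"
      using additive_subgroup.zero_closed[OF ideal.axioms(1)[OF genideal_ideal[of "{}"]]] by simp
  qed
  also have "\<zero>\<^bsub>poly_ring 2\<^esub> = (0 :: 'k mpoly)"
    by (simp add: poly_ring_def)
  finally show ?thesis .
qed


section \<open>Krull dimension, depth, and the Cohen-Macaulay property\<close>

definition krull_dim :: "('a, 'b) ring_scheme \<Rightarrow> enat" where
  "krull_dim R = Sup {enat d | d. \<exists>P :: nat \<Rightarrow> 'a set.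
     (\<forall>i\<le>d. primeideal (P i) R) \<and> (\<forall>i<d. P i \<subset> P (Suc i))}"

definition nonzerodivisor :: "('a, 'b) ring_scheme \<Rightarrow> 'a \<Rightarrow> bool" where
  "nonzerodivisor R x \<longleftrightarrow> (\<forall>y\<in>carrier R. x \<otimes>\<^bsub>R\<^esub> y = \<zero>\<^bsub>R\<^esub> \<longrightarrow> y = \<zero>\<^bsub>R\<^esub>)"

definition regular_sequence :: "('a, 'b) ring_scheme \<Rightarrow> 'a list \<Rightarrow> bool" where
  "regular_sequence R xs \<longleftrightarrow>
     set xs \<subseteq> carrier R \<and>
     (\<forall>i<length xs. let J = Idl\<^bsub>R\<^esub> (set (take i xs))
        in nonzerodivisor (R Quot J) (J +>\<^bsub>R\<^esub> xs ! i)) \<and>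
     Idl\<^bsub>R\<^esub> (set xs) \<noteq> carrier R"

definition depth :: "('a, 'b) ring_scheme \<Rightarrow> 'a set \<Rightarrow> enat" where
  "depth R J = Sup {enat (length xs) | xs. set xs \<subseteq> J \<and> regular_sequence R xs}"

text \<open>
  For an ideal \<open>I\<close> of \<open>S = poly_ring n\<close>, the graded maximal ideal of \<open>S Quot I\<close> is the image of
  $(x_1, \ldots, x_n)$.
\<close>

definition cohen_macaulay_quotient :: "nat \<Rightarrow> 'k::field mpoly set \<Rightarrow> bool" where
  "cohen_macaulay_quotient n I \<longleftrightarrow>
     (let S = poly_ring n; R = S Quot I
      in depth R ((+>\<^bsub>S\<^esub>) I ` irrelevant_ideal n) = krull_dim R)"

end

theory Submission
  imports Defs "HOL-Computational_Algebra.Polynomial"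
begin

text \<open>
  For $n \ge 5$ the simplicial complex of the square-free monomial ideal $I = I_3(P_n^2)$ is not
  pure: it has a facet \<open>F\<close> and a face \<open>F'\<close> with $|F'| = |F| + 1$. The primes $(x_i : i \notin T)$ for
  $T \subseteq F'$ give $\dim S/I \ge |F'|$, and the depth is at most $|F|$ because
  $(x_i : i \notin F)$ is an associated prime of \<open>I\<close>. For $n = 3, 4$ the ideal \<open>I\<close> is
  generated by all square-free cubic monomials; then $\dim S/I = 2$, and the first two elementary
  symmetric polynomials form a regular sequence modulo \<open>I\<close>.

  Both upper bounds rest on one argument: more than $|T|$ elements of \<open>S\<close> are algebraically dependent
  modulo $(x_i : i \notin T)$, and a dependence relation read from its lexicographically lowest term
  forces \<open>1\<close> into the last ideal of any chain along which each element is a nonzerodivisor modulo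
  one ideal and lies in the next.
\<close>

section \<open>Ideals of a quotient ring\<close>

text \<open>No localisation, Ext or transcendence degree enters: the dependence argument replaces
  them, for two kinds of chain. A chain of primes \<open>Q 0 \<subset> ... \<subset> Q e\<close>
  supplies elements chosen in \<open>Q (Suc i)\<close> outside \<open>Q i\<close>; primality makes
  them cancellable modulo \<open>Q i\<close>. A regular sequence a_1, ..., a_r supplies the ideals
  (I + (a_1, ..., a_i)) : x_F. There 1 in the last ideal only says that x_F lies in I + (a_1, ...,
  a_r), which is no contradiction by itself; therefore regularity is first carried over to high
  powers, and this is the purpose of the exact sequence argument. The field is arbitrary, which
  shapes the case n = 3, 4. On the line x_i = t, x_j = -t with all other coordinates 0, a second
  linear form with coefficients c_1, ..., c_n has the value (c_i - c_j) t; it would need n distinct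
  coefficients, and a field with two elements lacks them. The second symmetric polynomial has the
  value -t^2 on every line, in every characteristic. To cancel it, I + (e_1) has to be the full
  vanishing ideal of the lines, hence the explicit standard monomials.\<close>

lemma nonzerodivisor_Quot_iff:
  fixes R (structure)
  assumes "ideal J R" "x \<in> carrier R"
  shows "nonzerodivisor (R Quot J) (J +>\<^bsub>R\<^esub> x) \<longleftrightarrow>
    (\<forall>y\<in>carrier R. x \<otimes>\<^bsub>R\<^esub> y \<in> J \<longrightarrow> y \<in> J)"
proof -
  interpret ideal J R by fact
  have coset_eq: "J +> y = J \<longleftrightarrow> y \<in> J" if "y \<in> carrier R" for y
    using that a_rcos_const rcos_const_imp_mem by blast
  have carr: "carrier (R Quot J) = (+>) J ` carrier R"
    unfolding FactRing_def A_RCOSETS_def' by auto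
  have mult: "(J +> x) \<otimes>\<^bsub>R Quot J\<^esub> (J +> y) = J +> (x \<otimes> y)" if "y \<in> carrier R" for y
    using that assms(2) by (simp add: FactRing_def rcoset_mult_add)
  have zero: "\<zero>\<^bsub>R Quot J\<^esub> = J" by (simp add: FactRing_def)
  show ?thesis
    using assms(2) by (auto simp: nonzerodivisor_def carr mult zero coset_eq)
qed

text \<open>Since \<open>I \<subseteq> J\<close>, the ideal \<open>J\<close> is a union of cosets of
  \<open>I\<close>, so passing to the image loses nothing. This is how questions about ideals of the
  quotient are pulled back to the ring itself.\<close>

lemma (in ring) rcos_mem_image_iff:
  assumes "ideal I R" "ideal J R" "I \<subseteq> J" "a \<in> carrier R"
  shows "I +> a \<in> (+>) I ` J \<longleftrightarrow> a \<in> J"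
proof -
  have "ideal ((+>) I ` J) (R Quot I)"
    using assms by (intro ring_ideal_imp_quot_ideal)
  then have sub: "(+>) I ` J \<subseteq> carrier (R Quot I)"
    by (simp add: additive_subgroup.a_subset ideal_def)
  have "\<Union> ((+>) I ` J) = J"
    using iffD1[OF ideal_incl_iff[OF assms(1,2)] assms(3)] by (rule sym)
  then show ?thesis
    using canonical_proj_vimage_mem_iff[OF assms(1) sub assms(4)] by simp
qed

text \<open>Pushes a chain of primes down to the quotient, for the lower bound on the dimension; the
  preimage lemma after it lifts chains, for the upper bound.\<close>

lemma (in cring) primeideal_Quot_image:
  assumes I: "ideal I R" and P: "primeideal P R" "I \<subseteq> P"
  shows "primeideal ((+>) I ` P) (R Quot I)"
proof -
  interpret I: ideal I R by fact
  interpret P: primeideal P R by fact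
  have carr: "carrier (R Quot I) = (+>) I ` carrier R"
    unfolding FactRing_def A_RCOSETS_def' by auto
  note mem = rcos_mem_image_iff[OF I P.is_ideal P(2)]
  show ?thesis
  proof (rule primeidealI)
    show "ideal ((+>) I ` P) (R Quot I)"
      by (rule ring_ideal_imp_quot_ideal[OF I P.is_ideal])
    show "cring (R Quot I)" by (rule I.quotient_is_cring[OF is_cring])
    obtain a where "a \<in> carrier R" "a \<notin> P"
      using P.I_notcarr P.a_subset by blast
    then show "carrier (R Quot I) \<noteq> (+>) I ` P"
      using mem[of a] carr by (metis imageI)
    fix a b assume "a \<in> carrier (R Quot I)" "b \<in> carrier (R Quot I)"
      and ab: "a \<otimes>\<^bsub>R Quot I\<^esub> b \<in> (+>) I ` P"
    then obtain p q where pq: "p \<in> carrier R" "q \<in> carrier R" "a = I +> p" "b = I +> q"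
      unfolding carr by blast
    then have "I +> (p \<otimes> q) \<in> (+>) I ` P"
      using ab by (simp add: FactRing_def I.rcoset_mult_add)
    then have "p \<in> P \<or> q \<in> P"
      using pq mem[of "p \<otimes> q"] P.I_prime by simp
    then show "a \<in> (+>) I ` P \<or> b \<in> (+>) I ` P" using pq by blast
  qed
qed

lemma (in cring) primeideal_Quot_vimage:
  assumes I: "ideal I R" and Q: "primeideal Q (R Quot I)"
  shows "primeideal {a \<in> carrier R. I +> a \<in> Q} R"
proof -
  interpret I: ideal I R by fact
  interpret Q: primeideal Q "R Quot I" by fact
  interpret h: ring_hom_ring R "R Quot I" "(+>) I" by (rule I.rcos_ring_hom_ring)
  have carr: "carrier (R Quot I) = (+>) I ` carrier R"
    unfolding FactRing_def A_RCOSETS_def' by auto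
  show ?thesis
  proof (rule primeidealI)
    show "ideal {a \<in> carrier R. I +> a \<in> Q} R" by (rule h.ideal_vimage[OF Q.is_ideal])
    show "cring R" by (rule is_cring)
    obtain a where "a \<in> carrier R" "I +> a \<notin> Q"
      using Q.I_notcarr Q.a_subset unfolding carr by blast
    then show "carrier R \<noteq> {a \<in> carrier R. I +> a \<in> Q}" by blast
    fix a b assume "a \<in> carrier R" "b \<in> carrier R" "a \<otimes> b \<in> {a \<in> carrier R. I +> a \<in> Q}"
    then show "a \<in> {a \<in> carrier R. I +> a \<in> Q} \<or> b \<in> {a \<in> carrier R. I +> a \<in> Q}"
      using Q.I_prime[of "I +> a" "I +> b"] by auto
  qed
qed


section \<open>Ideals of the polynomial ring\<close>

lemma poly_ring_simps [simp]:
  "(\<otimes>\<^bsub>poly_ring n\<^esub>) = (*)" "(\<oplus>\<^bsub>poly_ring n\<^esub>) = (+)"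
  "\<one>\<^bsub>poly_ring n\<^esub> = 1" "\<zero>\<^bsub>poly_ring n\<^esub> = 0"
  by (simp_all add: poly_ring_def)

lemma poly_ring_closed_const [simp]:
  "0 \<in> carrier (poly_ring n)" "1 \<in> carrier (poly_ring n)"
  by (simp_all add: poly_ring_def)

lemma poly_ring_closed:
  assumes "p \<in> carrier (poly_ring n)" "q \<in> carrier (poly_ring n)"
  shows "p + q \<in> carrier (poly_ring n)" "p * q \<in> carrier (poly_ring n)"
proof -
  interpret S: cring "poly_ring n" by (rule poly_ring_cring)
  show "p + q \<in> carrier (poly_ring n)" "p * q \<in> carrier (poly_ring n)"
    using S.add.m_closed[of p q] S.m_closed[of p q] assms by simp_all
qed

lemma poly_ring_closed_uminus: "p \<in> carrier (poly_ring n) \<Longrightarrow> - p \<in> carrier (poly_ring n)"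
  by (simp add: poly_ring_def in_keys_iff)

lemma poly_ring_closed_minus:
  "p \<in> carrier (poly_ring n) \<Longrightarrow> q \<in> carrier (poly_ring n) \<Longrightarrow> p - q \<in> carrier (poly_ring n)"
  using poly_ring_closed(1)[of p n "- q"] poly_ring_closed_uminus[of q n] by simp

lemma poly_ring_closed_power: "p \<in> carrier (poly_ring n) \<Longrightarrow> p ^ k \<in> carrier (poly_ring n)"
  by (induction k) (auto intro: poly_ring_closed)

lemma poly_ring_sum_closed:
  "(\<And>i. i \<in> A \<Longrightarrow> f i \<in> carrier (poly_ring n)) \<Longrightarrow> sum f A \<in> carrier (poly_ring n)"
  by (induction A rule: infinite_finite_induct) (auto intro: poly_ring_closed)

lemma single_in_poly_ring: "Poly_Mapping.keys m \<subseteq> {1..n} \<Longrightarrow> Poly_Mapping.single m c \<in> carrier (poly_ring n)"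
  by (simp add: poly_ring_def)

lemma poly_ring_idealI:
  fixes J :: "'k::comm_ring_1 mpoly set"
  assumes "J \<subseteq> carrier (poly_ring n)" "0 \<in> J" "\<And>p q. p \<in> J \<Longrightarrow> q \<in> J \<Longrightarrow> p + q \<in> J"
    "\<And>p q. p \<in> carrier (poly_ring n) \<Longrightarrow> q \<in> J \<Longrightarrow> p * q \<in> J"
  shows "ideal J (poly_ring n)"
proof -
  interpret S: cring "poly_ring n :: 'k mpoly ring" by (rule poly_ring_cring)
  have neg: "- p \<in> J" if "p \<in> J" for p
    using assms(4)[of "- 1" p] that poly_ring_closed_uminus[of 1 n] by simp
  have minus: "\<ominus>\<^bsub>poly_ring n\<^esub> p = - p" if "p \<in> carrier (poly_ring n)" for p :: "'k mpoly"
    using S.minus_equality[of "- p" p] that poly_ring_closed_uminus[of p n] by simp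
  show ?thesis
  proof (rule idealI)
    show "ring (poly_ring n :: 'k mpoly ring)" by (rule S.ring_axioms)
    show "subgroup J (add_monoid (poly_ring n))"
    proof (rule S.add.subgroupI)
      show "J \<noteq> {}" using assms(2) by auto
    next
      fix a assume "a \<in> J"
      then show "\<ominus>\<^bsub>poly_ring n\<^esub> a \<in> J" using neg minus assms(1) by auto
    qed (use assms in auto)
    fix a x :: "'k mpoly" assume "a \<in> J" "x \<in> carrier (poly_ring n)"
    then show "x \<otimes>\<^bsub>poly_ring n\<^esub> a \<in> J" "a \<otimes>\<^bsub>poly_ring n\<^esub> x \<in> J"
      using assms(4)[of x a] by (simp_all add: mult.commute)
  qed
qed

lemma poly_ring_idealD:
  fixes J :: "'k::comm_ring_1 mpoly set"
  assumes "ideal J (poly_ring n)"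
  shows "J \<subseteq> carrier (poly_ring n)" "0 \<in> J" "p \<in> J \<Longrightarrow> q \<in> J \<Longrightarrow> p + q \<in> J"
    "p \<in> carrier (poly_ring n) \<Longrightarrow> q \<in> J \<Longrightarrow> p * q \<in> J"
    "p \<in> carrier (poly_ring n) \<Longrightarrow> q \<in> J \<Longrightarrow> q * p \<in> J"
    "p \<in> J \<Longrightarrow> - p \<in> J" "p \<in> J \<Longrightarrow> q \<in> J \<Longrightarrow> p - q \<in> J"
proof -
  interpret J: ideal J "poly_ring n" by fact
  show sub: "J \<subseteq> carrier (poly_ring n)" by (rule J.a_subset)
  show "0 \<in> J" using additive_subgroup.zero_closed[OF J.is_additive_subgroup] by simp
  show add: "p \<in> J \<Longrightarrow> q \<in> J \<Longrightarrow> p + q \<in> J" for p q using additive_subgroup.a_closed[OF J.is_additive_subgroup, of p q] by simp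
  show l: "p \<in> carrier (poly_ring n) \<Longrightarrow> q \<in> J \<Longrightarrow> p * q \<in> J" for p q using J.I_l_closed[of q p] by simp
  show "p \<in> carrier (poly_ring n) \<Longrightarrow> q \<in> J \<Longrightarrow> q * p \<in> J" using J.I_r_closed[of q p] by simp
  show neg: "p \<in> J \<Longrightarrow> - p \<in> J" for p
    using l[of "- 1" p] poly_ring_closed_uminus[of 1 n] by simp
  show "p \<in> J \<Longrightarrow> q \<in> J \<Longrightarrow> p - q \<in> J"
    using add[of p "- q"] neg[of q] by simp
qed

lemma poly_ring_ideal_sum:
  fixes J :: "'k::comm_ring_1 mpoly set"
  assumes J: "ideal J (poly_ring n)" and f: "\<And>i. i \<in> A \<Longrightarrow> f i \<in> J"
  shows "sum f A \<in> J"
proof -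
  have zero: "0 \<in> J" by (rule poly_ring_idealD(2)[OF J])
  show ?thesis
    using f by (induction A rule: infinite_finite_induct) (simp_all add: zero poly_ring_idealD(3)[OF J])
qed

text \<open>One predicate on exponents encodes all the monomial ideals in use: path ideals, primes
  generated by variables, and polynomials without terms of low degree. It yields an ideal once
  \<open>Q\<close> is stable under multiplication by monomials.\<close>

definition mono_ideal :: "nat \<Rightarrow> ((nat \<Rightarrow>\<^sub>0 nat) \<Rightarrow> bool) \<Rightarrow> 'k::comm_ring_1 mpoly set" where
  "mono_ideal n Q = {p \<in> carrier (poly_ring n). \<forall>m\<in>Poly_Mapping.keys p. Q m}"

lemma mono_ideal_ideal:
  assumes "\<And>m m'. Q m \<Longrightarrow> Q (m' + m)"
  shows "ideal (mono_ideal n Q :: 'k::comm_ring_1 mpoly set) (poly_ring n)"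
proof (rule poly_ring_idealI)
  fix p q :: "'k mpoly"
  assume "p \<in> mono_ideal n Q" "q \<in> mono_ideal n Q"
  then show "p + q \<in> mono_ideal n Q"
    using Poly_Mapping.keys_add[of p q] by (auto simp: mono_ideal_def poly_ring_closed)
next
  fix p q :: "'k mpoly"
  assume "p \<in> carrier (poly_ring n)" "q \<in> mono_ideal n Q"
  then show "p * q \<in> mono_ideal n Q"
    using Poly_Mapping.keys_mult[of p q] assms by (auto simp: mono_ideal_def poly_ring_closed)
qed (auto simp: mono_ideal_def poly_ring_closed)

lemma mono_ideal_mult:
  assumes "p \<in> mono_ideal n Q" "q \<in> mono_ideal n Q'" "\<And>m m'. Q m \<Longrightarrow> Q' m' \<Longrightarrow> Q'' (m + m')"
  shows "p * q \<in> mono_ideal n Q''"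
  using assms Poly_Mapping.keys_mult[of p q] by (fastforce simp: mono_ideal_def poly_ring_closed)

lemma keys_plus_nat: "Poly_Mapping.keys (m + m' :: nat \<Rightarrow>\<^sub>0 nat) = Poly_Mapping.keys m \<union> Poly_Mapping.keys m'"
  by (auto simp: in_keys_iff lookup_add)

lemma poly_mapping_expand: "(\<Sum>m\<in>Poly_Mapping.keys p. Poly_Mapping.single m (Poly_Mapping.lookup p m)) = p"
  by (rule poly_mapping_eqI) (auto simp: lookup_sum lookup_single when_def in_keys_iff sum.delta' if_distrib cong: if_cong)

lemma mono_ideal_subsetI:
  fixes J :: "'k::comm_ring_1 mpoly set"
  assumes "ideal J (poly_ring n)"
    "\<And>m c. Poly_Mapping.keys m \<subseteq> {1..n} \<Longrightarrow> Q m \<Longrightarrow> Poly_Mapping.single m c \<in> J"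
  shows "mono_ideal n Q \<subseteq> J"
proof
  fix p :: "'k mpoly" assume p: "p \<in> mono_ideal n Q"
  have "(\<Sum>m\<in>Poly_Mapping.keys p. Poly_Mapping.single m (Poly_Mapping.lookup p m)) \<in> J"
    by (rule poly_ring_ideal_sum[OF assms(1)])
      (use p assms(2) in \<open>auto simp: mono_ideal_def poly_ring_def\<close>)
  then show "p \<in> J" by (simp add: poly_mapping_expand)
qed

section \<open>Regular sequences\<close>

text \<open>The sum B + aS in explicit form instead of a generated ideal: the exchange arguments
  below compute with the witnesses \<open>b\<close> and \<open>s\<close>.\<close>

definition adjoin :: "nat \<Rightarrow> 'k::comm_ring_1 mpoly set \<Rightarrow> 'k mpoly \<Rightarrow> 'k mpoly set" where
  "adjoin n B a = {b + a * s | b s. b \<in> B \<and> s \<in> carrier (poly_ring n)}"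

definition colon :: "nat \<Rightarrow> 'k::comm_ring_1 mpoly set \<Rightarrow> 'k mpoly \<Rightarrow> 'k mpoly set" where
  "colon n B g = {y \<in> carrier (poly_ring n). g * y \<in> B}"

text \<open>Only the cancellation part of regularity. Properness of the final ideal is kept apart,
  because colon ideals may be the whole ring and the exact sequence argument must still apply to
  them.\<close>

primrec regular_mod :: "nat \<Rightarrow> 'k::comm_ring_1 mpoly set \<Rightarrow> 'k mpoly list \<Rightarrow> bool" where
  "regular_mod n B [] \<longleftrightarrow> True"
| "regular_mod n B (a # as) \<longleftrightarrow>
     (\<forall>y\<in>carrier (poly_ring n). a * y \<in> B \<longrightarrow> y \<in> B) \<and> regular_mod n (adjoin n B a) as"

lemma adjoinI: "x = b + a * s \<Longrightarrow> b \<in> B \<Longrightarrow> s \<in> carrier (poly_ring n) \<Longrightarrow> x \<in> adjoin n B a"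
  unfolding adjoin_def by blast

lemma adjoinE:
  assumes "x \<in> adjoin n B a"
  obtains b s where "x = b + a * s" "b \<in> B" "s \<in> carrier (poly_ring n)"
  using assms unfolding adjoin_def by blast

lemma adjoin_ideal:
  fixes B :: "'k::comm_ring_1 mpoly set"
  assumes B: "ideal B (poly_ring n)" and a: "a \<in> carrier (poly_ring n)"
  shows "ideal (adjoin n B a) (poly_ring n)"
proof (rule poly_ring_idealI)
  show "adjoin n B a \<subseteq> carrier (poly_ring n)"
    using poly_ring_idealD(1)[OF B] a by (auto simp: adjoin_def intro!: poly_ring_closed)
  show "0 \<in> adjoin n B a"
    using poly_ring_idealD(2)[OF B] by (intro adjoinI[of _ 0 _ 0]) auto
next
  fix p q :: "'k mpoly" assume "p \<in> adjoin n B a" "q \<in> adjoin n B a"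
  then obtain b s b' s' where "p = b + a * s" "q = b' + a * s'" "b \<in> B" "b' \<in> B"
    "s \<in> carrier (poly_ring n)" "s' \<in> carrier (poly_ring n)"
    by (auto simp: adjoin_def)
  then show "p + q \<in> adjoin n B a"
    using poly_ring_idealD(3)[OF B]
    by (intro adjoinI[of _ "b + b'" _ "s + s'"]) (auto simp: algebra_simps intro: poly_ring_closed)
next
  fix p q :: "'k mpoly" assume p: "p \<in> carrier (poly_ring n)" and "q \<in> adjoin n B a"
  then obtain b s where "q = b + a * s" "b \<in> B" "s \<in> carrier (poly_ring n)"
    by (auto simp: adjoin_def)
  then show "p * q \<in> adjoin n B a"
    using poly_ring_idealD(4)[OF B p] poly_ring_closed(2)[OF p]
    by (intro adjoinI[of _ "p * b" _ "p * s"]) (simp_all add: distrib_left mult.left_commute[of p a])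
qed

lemma adjoin_self:
  assumes "ideal B (poly_ring n)"
  shows "a \<in> adjoin n B a"
  using poly_ring_idealD(2)[OF assms] by (intro adjoinI[of _ 0 _ 1]) auto

lemma adjoin_supset: "B \<subseteq> adjoin n B a"
proof
  fix b assume "b \<in> B"
  then show "b \<in> adjoin n B a"
    by (intro adjoinI[of _ b _ 0]) auto
qed

lemma adjoin_least:
  assumes "ideal J (poly_ring n)" "B \<subseteq> J" "a \<in> J"
  shows "adjoin n B a \<subseteq> J"
proof
  fix x assume "x \<in> adjoin n B a"
  then obtain b s where "x = b + a * s" "b \<in> B" "s \<in> carrier (poly_ring n)" by (rule adjoinE)
  then show "x \<in> J"
    using assms(2,3) poly_ring_idealD(3,5)[OF assms(1)] by blast
qed

lemma adjoin_commute: "adjoin n (adjoin n B a) b = adjoin n (adjoin n B b) a"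
proof -
  have "adjoin n (adjoin n B a) b \<subseteq> adjoin n (adjoin n B b) a" for a b
  proof
    fix x assume "x \<in> adjoin n (adjoin n B a) b"
    then obtain c s t where "x = (c + a * s) + b * t" "c \<in> B"
      "s \<in> carrier (poly_ring n)" "t \<in> carrier (poly_ring n)"
      unfolding adjoin_def by blast
    moreover from this have "x = (c + b * t) + a * s" by (simp add: algebra_simps)
    ultimately show "x \<in> adjoin n (adjoin n B b) a" unfolding adjoin_def by blast
  qed
  then show ?thesis by blast
qed

lemma colon_ideal:
  assumes B: "ideal B (poly_ring n)"
  shows "ideal (colon n B g) (poly_ring n)"
  using poly_ring_idealD(2,3,4)[OF B]
  by (intro poly_ring_idealI) (auto simp: colon_def distrib_left mult.left_commute[of g] poly_ring_closed)

text \<open>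
  For \<open>S/C\<close> this is the exact sequence
  $0 \to S/(C : g) \to S/C \to S/(C + gS) \to 0$: a sequence that is regular on both ends is
  regular in the middle.
\<close>

lemma regular_mod_extension:
  assumes "ideal C (poly_ring n)" "g \<in> carrier (poly_ring n)" "set as \<subseteq> carrier (poly_ring n)"
    and "regular_mod n (adjoin n C g) as" "regular_mod n (colon n C g) as"
  shows "regular_mod n C as"
  using assms
proof (induction as arbitrary: C)
  case (Cons x as)
  note C = Cons.prems(1)
  note D = poly_ring_idealD[OF C]
  have x: "x \<in> carrier (poly_ring n)" using Cons.prems(3) by simp
  have cancel_D: "y \<in> adjoin n C g" if "y \<in> carrier (poly_ring n)" "x * y \<in> adjoin n C g" for y
    using Cons.prems(4) that by simp
  have cancel_colon: "g * y \<in> C" if "y \<in> carrier (poly_ring n)" "g * (x * y) \<in> C" for y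
    using Cons.prems(5) that x by (auto simp: colon_def poly_ring_closed)
  have cancel: "y \<in> C" if y: "y \<in> carrier (poly_ring n)" "x * y \<in> C" for y
  proof -
    have "y \<in> adjoin n C g" using cancel_D y adjoin_supset[of C n g] by blast
    then obtain c s where cs: "y = c + g * s" "c \<in> C" "s \<in> carrier (poly_ring n)"
      by (auto simp: adjoin_def)
    have "g * (x * s) = x * y - x * c" by (simp add: cs(1) algebra_simps)
    also have "\<dots> \<in> C" using D(4,7) x cs(2) y(2) by blast
    finally have "g * s \<in> C" using cancel_colon cs(3) by blast
    then show "y \<in> C" using cs D(3) by simp
  qed
  \<comment> \<open>Taking the colon by \<open>g\<close> commutes with adjoining \<open>x\<close>,
    because \<open>x\<close> is cancellable modulo C + gS. This turns the regularity over
    \<open>colon n C g\<close> into the one that the induction hypothesis for C + xS asks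
    for.\<close>
  have "colon n (adjoin n C x) g \<subseteq> adjoin n (colon n C g) x"
  proof
    fix y assume "y \<in> colon n (adjoin n C x) g"
    then obtain c s where y: "y \<in> carrier (poly_ring n)" "g * y = c + x * s" "c \<in> C" "s \<in> carrier (poly_ring n)"
      by (auto simp: colon_def adjoin_def)
    have "x * s = - c + g * y" using y(2) by (simp add: algebra_simps)
    then have "x * s \<in> adjoin n C g" using y(1,3) D(6) by (intro adjoinI)
    then obtain c' t where ct: "s = c' + g * t" "c' \<in> C" "t \<in> carrier (poly_ring n)"
      using cancel_D[OF y(4)] by (auto simp: adjoin_def)
    have "g * (y - x * t) = c + x * c'" using y(2) ct(1) by (simp add: algebra_simps)
    also have "\<dots> \<in> C" using D(3,4) x y(3) ct(2) by blast
    finally have "y - x * t \<in> colon n C g"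
      using y(1) x ct(3) by (simp add: colon_def poly_ring_closed poly_ring_closed_minus)
    then show "y \<in> adjoin n (colon n C g) x"
        using ct(3) by (intro adjoinI[of _ "y - x * t" _ t]) auto
  qed
  moreover have "adjoin n (colon n C g) x \<subseteq> colon n (adjoin n C x) g"
  proof
    fix y assume "y \<in> adjoin n (colon n C g) x"
    then obtain z s where y: "y = z + x * s" "z \<in> carrier (poly_ring n)" "g * z \<in> C" "s \<in> carrier (poly_ring n)"
      by (auto simp: colon_def adjoin_def)
    have "g * y = g * z + x * (g * s)" by (simp add: y(1) algebra_simps)
    then show "y \<in> colon n (adjoin n C x) g"
      using y x Cons.prems(2) by (auto simp: colon_def adjoin_def intro!: poly_ring_closed)
  qed
  ultimately have "regular_mod n (colon n (adjoin n C x) g) as"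
    using Cons.prems(5) by simp
  moreover have "regular_mod n (adjoin n (adjoin n C x) g) as"
    using Cons.prems(4) by (simp add: adjoin_commute[of n C x g])
  ultimately have "regular_mod n (adjoin n C x) as"
    using Cons.IH[OF adjoin_ideal[OF C x] Cons.prems(2)] Cons.prems(3) by simp
  with cancel show ?case by simp
qed simp

lemma cancel_power:
  assumes "\<And>y. y \<in> carrier (poly_ring n) \<Longrightarrow> a * y \<in> B \<Longrightarrow> y \<in> B" "a \<in> carrier (poly_ring n)"
  shows "y \<in> carrier (poly_ring n) \<Longrightarrow> a ^ k * y \<in> B \<Longrightarrow> y \<in> B"
proof (induction k)
  case (Suc k)
  then have "a * (a ^ k * y) \<in> B" by (simp add: mult.assoc)
  then show ?case
    using Suc assms by (blast intro: poly_ring_closed poly_ring_closed_power)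
qed simp

text \<open>Induction on the exponent through the exact sequence with g = a and C = B + a^(k+2) S.
  Since \<open>a\<close> is cancellable modulo \<open>B\<close>, the colon C : a is B + a^(k+1) S,
  where the induction hypothesis applies, while C + aS is B + aS, where the original sequence is
  regular.\<close>

lemma regular_mod_power_hd:
  assumes B: "ideal B (poly_ring n)" and as: "set (a # as) \<subseteq> carrier (poly_ring n)"
    and reg: "regular_mod n B (a # as)"
  shows "regular_mod n (adjoin n B (a ^ Suc k)) as"
proof (induction k)
  case (Suc k)
  let ?C = "adjoin n B (a ^ Suc (Suc k))"
  have a: "a \<in> carrier (poly_ring n)" using as by simp
  note D = poly_ring_idealD[OF B]
  have pow: "a ^ i \<in> carrier (poly_ring n)" for i by (rule poly_ring_closed_power[OF a])
  have C: "ideal ?C (poly_ring n)" by (rule adjoin_ideal[OF B pow])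
  have "adjoin n ?C a = adjoin n B a"
  proof
    have "a ^ Suc (Suc k) \<in> adjoin n B a"
      using poly_ring_idealD(5)[OF adjoin_ideal[OF B a] pow[of "Suc k"] adjoin_self[OF B]] by simp
    then show "adjoin n ?C a \<subseteq> adjoin n B a"
      by (intro adjoin_least adjoin_ideal B a adjoin_supset adjoin_self)
    show "adjoin n B a \<subseteq> adjoin n ?C a"
      using adjoin_supset[of B n "a ^ Suc (Suc k)"] adjoin_supset[of ?C n a]
      by (intro adjoin_least adjoin_ideal C a adjoin_self) auto
  qed
  moreover have "colon n ?C a = adjoin n B (a ^ Suc k)"
  proof
    show "colon n ?C a \<subseteq> adjoin n B (a ^ Suc k)"
    proof
      fix y assume "y \<in> colon n ?C a"
      then obtain b s where y: "y \<in> carrier (poly_ring n)" "a * y = b + a ^ Suc (Suc k) * s"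
        "b \<in> B" "s \<in> carrier (poly_ring n)"
        by (auto simp: colon_def adjoin_def)
      have "a * (y - a ^ Suc k * s) \<in> B" using y(2,3) by (simp add: algebra_simps)
      then have "y - a ^ Suc k * s \<in> B"
        using reg y(1,4) pow[of "Suc k"] by (simp del: power_Suc add: poly_ring_closed poly_ring_closed_minus)
      then show "y \<in> adjoin n B (a ^ Suc k)"
        using y(4) by (intro adjoinI[of _ "y - a ^ Suc k * s" _ s]) auto
    qed
    show "adjoin n B (a ^ Suc k) \<subseteq> colon n ?C a"
    proof (rule adjoin_least[OF colon_ideal[OF C]])
      show "B \<subseteq> colon n ?C a"
        using D(1) D(4)[OF a] adjoin_supset[of B n "a ^ Suc (Suc k)"] by (auto simp: colon_def)
      show "a ^ Suc k \<in> colon n ?C a"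
        using pow[of "Suc k"] adjoin_self[OF B, of "a ^ Suc (Suc k)"] by (simp add: colon_def)
    qed
  qed
  ultimately show ?case
    using regular_mod_extension[OF C a, of as] as reg Suc.IH by simp
qed (use reg in simp)

lemma regular_mod_power:
  assumes "ideal B (poly_ring n)" "set as \<subseteq> carrier (poly_ring n)" "regular_mod n B as"
  shows "regular_mod n B (map (\<lambda>a. a ^ Suc k) as)"
  using assms
proof (induction as arbitrary: B)
  case (Cons a as)
  have a: "a \<in> carrier (poly_ring n)" using Cons.prems by simp
  have "y \<in> B" if "y \<in> carrier (poly_ring n)" "a ^ Suc k * y \<in> B" for y
    by (rule cancel_power[OF _ a that]) (use Cons.prems(3) in auto)
  moreover have "regular_mod n (adjoin n B (a ^ Suc k)) (map (\<lambda>a. a ^ Suc k) as)"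
    using regular_mod_power_hd[OF Cons.prems] Cons.prems(2)
    by (intro Cons.IH adjoin_ideal Cons.prems(1) poly_ring_closed_power[OF a]) auto
  ultimately show ?case by (simp del: power_Suc)
qed simp

section \<open>Algebraic dependence\<close>

text \<open>Gaussian elimination on a homogeneous system with more unknowns than equations, one
  equation \<open>b\<close> at a time: \<open>a0\<close> is the pivot, \<open>w\<close> are the
  other vectors cleared in coordinate \<open>b\<close>, and the coefficient of \<open>a0\<close> is
  solved for at the end.\<close>

lemma exists_linear_relation:
  fixes v :: "'a \<Rightarrow> 'b \<Rightarrow> 'k::field"
  assumes "finite A" "finite B" "card B < card A"
  shows "\<exists>c. (\<exists>a\<in>A. c a \<noteq> 0) \<and> (\<forall>b\<in>B. (\<Sum>a\<in>A. c a * v a b) = 0)"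
  using assms(2,1,3)
proof (induction B arbitrary: A v rule: finite_induct)
  case empty
  then obtain a where "a \<in> A" by fastforce
  then show ?case by (intro exI[of _ "\<lambda>_. 1"]) auto
next
  case (insert b B)
  show ?case
  proof (cases "\<forall>a\<in>A. v a b = 0")
    case True
    from insert obtain c where "\<exists>a\<in>A. c a \<noteq> 0" "\<forall>b\<in>B. (\<Sum>a\<in>A. c a * v a b) = 0"
      by (metis card_insert_disjoint lessI less_trans)
    with True show ?thesis by (intro exI[of _ c]) auto
  next
    case False
    then obtain a0 where a0: "a0 \<in> A" "v a0 b \<noteq> 0" by blast
    let ?A = "A - {a0}"
    define w where "w a x = v a x - v a b / v a0 b * v a0 x" for a x
    have "finite ?A" "card B < card ?A"
      using insert.prems insert.hyps a0(1) by auto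
    from insert.IH[OF this, of w] obtain c where
      c: "\<exists>a\<in>?A. c a \<noteq> 0" "\<And>x. x \<in> B \<Longrightarrow> (\<Sum>a\<in>?A. c a * w a x) = 0" by blast
    have w_b: "w a b = 0" for a using a0(2) by (simp add: w_def)
    define d where "d = c(a0 := - (\<Sum>a\<in>?A. c a * v a b) / v a0 b)"
    have sum_d: "(\<Sum>a\<in>A. d a * v a x) = (\<Sum>a\<in>?A. c a * w a x)" for x
    proof -
      have "(\<Sum>a\<in>A. d a * v a x) = d a0 * v a0 x + (\<Sum>a\<in>?A. d a * v a x)"
        by (rule sum.remove[OF insert.prems(1) a0(1)])
      also have "(\<Sum>a\<in>?A. d a * v a x) = (\<Sum>a\<in>?A. c a * v a x)"
        by (rule sum.cong) (auto simp: d_def)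
      also have "d a0 * v a0 x = (\<Sum>a\<in>?A. c a * (- (v a b / v a0 b * v a0 x)))"
        unfolding d_def fun_upd_same sum_negf[symmetric] sum_divide_distrib sum_distrib_right
        by (rule sum.cong) simp_all
      finally show ?thesis
        by (simp add: w_def sum.distrib[symmetric] algebra_simps)
    qed
    show ?thesis
    proof (intro exI[of _ d] conjI)
      show "\<exists>a\<in>A. d a \<noteq> 0" using c(1) by (auto simp: d_def)
      show "\<forall>x\<in>insert b B. (\<Sum>a\<in>A. d a * v a x) = 0"
        using c(2) by (auto simp: sum_d w_b)
    qed
  qed
qed

section \<open>Counting products of powers against monomials\<close>

definition power_product :: "'a::comm_ring_1 list \<Rightarrow> nat list \<Rightarrow> 'a" where
  "power_product as es = prod_list (map2 (^) as es)"

lemma power_product_simps [simp]: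
  "power_product [] es = 1"
  "power_product (a # as) (e # es) = a ^ e * power_product as es"
  by (simp_all add: power_product_def)

text \<open>Exponents are bounded variable by variable and not in total, so that the monomials
  within the bound fill a box and are counted by a plain power.\<close>

definition exponents_le :: "nat \<Rightarrow> 'k::comm_ring_1 mpoly \<Rightarrow> bool" where
  "exponents_le d p \<longleftrightarrow> (\<forall>m\<in>Poly_Mapping.keys p. \<forall>i. Poly_Mapping.lookup m i \<le> d)"

lemma exponents_le_mult: "exponents_le d p \<Longrightarrow> exponents_le e q \<Longrightarrow> exponents_le (d + e) (p * q)"
  using Poly_Mapping.keys_mult[of p q] by (fastforce simp: exponents_le_def lookup_add intro: add_mono)

lemma exponents_le_power: "exponents_le d p \<Longrightarrow> exponents_le (k * d) (p ^ k)"
  by (induction k) (auto simp: exponents_le_mult, simp add: exponents_le_def)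

lemma exponents_le_mono: "exponents_le d p \<Longrightarrow> d \<le> e \<Longrightarrow> exponents_le e p"
  unfolding exponents_le_def by (meson order_trans)

lemma exponents_le_exists: "\<exists>d. exponents_le d p"
proof -
  let ?N = "\<Union>m\<in>Poly_Mapping.keys p. Poly_Mapping.range m"
  have "exponents_le (Max (insert 0 ?N)) p"
    unfolding exponents_le_def
  proof (intro ballI allI)
    fix m i assume "m \<in> Poly_Mapping.keys p"
    then show "Poly_Mapping.lookup m i \<le> Max (insert 0 ?N)"
      by (cases "i \<in> Poly_Mapping.keys m") (auto simp: in_keys_iff intro!: Max_ge dest: in_keys_lookup_in_range)
  qed
  then show ?thesis ..
qed

lemma exponents_le_list_exists: "\<exists>d. \<forall>a\<in>set as. exponents_le d a"
proof (induction as)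
  case (Cons a as)
  then obtain d where "\<forall>a\<in>set as. exponents_le d a" by blast
  moreover obtain e where "exponents_le e a" using exponents_le_exists by blast
  ultimately have "\<forall>x\<in>set (a # as). exponents_le (max d e) x"
    by (auto intro: exponents_le_mono)
  then show ?case by blast
qed simp

lemma exponents_le_power_product:
  assumes "length es = length as" "\<forall>a\<in>set as. exponents_le d a" "\<forall>e\<in>set es. e \<le> M"
  shows "exponents_le (length as * (M * d)) (power_product as es)"
  using assms
proof (induction es as rule: list_induct2)
  case (Cons e es a as)
  have "exponents_le (M * d) (a ^ e)"
    using exponents_le_power[of d a e] Cons.prems by (auto intro: exponents_le_mono)
  then show ?case using Cons by (simp add: exponents_le_mult)
qed (simp add: exponents_le_def)

lemma power_product_closed:
  assumes "length es = length as" "set as \<subseteq> carrier (poly_ring n)"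
  shows "power_product as es \<in> carrier (poly_ring n)"
  using assms by (induction es as rule: list_induct2) (auto intro: poly_ring_closed poly_ring_closed_power)

lemma bounded_monomials:
  fixes T :: "nat set"
  assumes "finite T"
  shows "finite {m. Poly_Mapping.keys m \<subseteq> T \<and> (\<forall>i. Poly_Mapping.lookup m i \<le> e)}" (is "finite ?B")
    and "card {m. Poly_Mapping.keys m \<subseteq> T \<and> (\<forall>i. Poly_Mapping.lookup m i \<le> e)} \<le> Suc e ^ card T"
proof -
  let ?f = "\<lambda>m :: nat \<Rightarrow>\<^sub>0 nat. restrict (Poly_Mapping.lookup m) T"
  have inj: "inj_on ?f ?B"
  proof (rule inj_onI, rule poly_mapping_eqI)
    fix m m' i assume m: "m \<in> ?B" "m' \<in> ?B" "?f m = ?f m'"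
    show "Poly_Mapping.lookup m i = Poly_Mapping.lookup m' i"
    proof (cases "i \<in> T")
      case True
      then show ?thesis using fun_cong[OF m(3), of i] by simp
    next
      case False
      then have "i \<notin> Poly_Mapping.keys m" "i \<notin> Poly_Mapping.keys m'" using m by auto
      then show ?thesis by (simp add: in_keys_iff)
    qed
  qed
  have sub: "?f ` ?B \<subseteq> PiE T (\<lambda>_. {..e})" by auto
  have fin: "finite (PiE T (\<lambda>_. {..e}))" using assms by (intro finite_PiE) auto
  show "finite ?B" using finite_imageD[OF finite_subset[OF sub fin] inj] .
  have "card ?B \<le> card (PiE T (\<lambda>_. {..e}))"
    using card_inj_on_le[OF inj sub fin] .
  then show "card ?B \<le> Suc e ^ card T"
    using assms by (simp add: card_PiE)
qed

text \<open>
  Counting monomials: the products of powers with exponents at most \<open>M\<close> outnumber the monomials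
  in the variables from \<open>T\<close> they can involve.
\<close>

lemma exists_algebraic_relation:
  fixes as :: "'k::field mpoly list"
  assumes T: "finite T" "card T < length as" and as: "set as \<subseteq> carrier (poly_ring n)"
  obtains A c where "finite A" "A \<noteq> {}" "\<And>es. es \<in> A \<Longrightarrow> length es = length as"
    "\<And>es. es \<in> A \<Longrightarrow> c es \<noteq> 0"
    "(\<Sum>es\<in>A. Poly_Mapping.single 0 (c es) * power_product as es)
      \<in> mono_ideal n (\<lambda>m. \<not> Poly_Mapping.keys m \<subseteq> T)"
proof -
  let ?r = "length as"
  obtain d where d: "\<forall>a\<in>set as. exponents_le d a" using exponents_le_list_exists by blast
  \<comment> \<open>Chosen for the count: the monomials number at most ((r d + 1)(M + 1))^|T| = M (M
    + 1)^|T|, which is less than (M + 1)^(|T| + 1) and hence than the (M + 1)^r power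
    products.\<close>
  define M where "M = (?r * d + 1) ^ card T"
  define E where "E = {es. set es \<subseteq> {..M} \<and> length es = ?r}"
  define e where "e = ?r * (M * d)"
  let ?B = "{m. Poly_Mapping.keys m \<subseteq> T \<and> (\<forall>i. Poly_Mapping.lookup m i \<le> e)}"
  have fin: "finite E" "card E = Suc M ^ ?r"
    unfolding E_def by (simp_all add: finite_lists_length_eq card_lists_length_eq)
  have "card ?B \<le> Suc e ^ card T" by (rule bounded_monomials(2)[OF T(1)])
  also have "Suc e \<le> (?r * d + 1) * Suc M"
    by (simp add: e_def algebra_simps)
  then have "Suc e ^ card T \<le> ((?r * d + 1) * Suc M) ^ card T" by (rule power_mono) simp
  also have "\<dots> = M * Suc M ^ card T" by (simp only: power_mult_distrib M_def)
  also have "\<dots> < Suc M * Suc M ^ card T" by simp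
  also have "\<dots> \<le> Suc M ^ ?r"
    using power_increasing[of "Suc (card T)" ?r "Suc M"] T(2) by simp
  finally have "card ?B < card E" by (simp add: fin)
  from exists_linear_relation[OF fin(1) bounded_monomials(1)[OF T(1)] this,
      of "\<lambda>es. Poly_Mapping.lookup (power_product as es)"]
  obtain c where c: "\<exists>es\<in>E. c es \<noteq> 0"
    and rel: "\<And>m. m \<in> ?B \<Longrightarrow> (\<Sum>es\<in>E. c es * Poly_Mapping.lookup (power_product as es) m) = 0"
    by blast
  \<comment> \<open>Vanishing coefficients are discarded so that whatever term survives the later
    elimination is certain to have an invertible coefficient.\<close>
  define A where "A = {es\<in>E. c es \<noteq> 0}"
  define p where "p = (\<Sum>es\<in>A. Poly_Mapping.single 0 (c es) * power_product as es)"
  have len: "length es = ?r" if "es \<in> A" for es using that by (simp add: A_def E_def)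
  have lookup: "Poly_Mapping.lookup p m = (\<Sum>es\<in>E. c es * Poly_Mapping.lookup (power_product as es) m)" for m
  proof -
    have "Poly_Mapping.lookup p m = (\<Sum>es\<in>A. c es * Poly_Mapping.lookup (power_product as es) m)"
      unfolding p_def lookup_sum
      by (intro sum.cong refl) (simp add: mult_map_scale_conv_mult[symmetric] Poly_Mapping.map.rep_eq when_def)
    also have "\<dots> = (\<Sum>es\<in>E. c es * Poly_Mapping.lookup (power_product as es) m)"
      unfolding A_def using fin(1) by (intro sum.mono_neutral_left) auto
    finally show ?thesis .
  qed
  have le: "exponents_le e (power_product as es)" if "es \<in> E" for es
    unfolding e_def using that d by (intro exponents_le_power_product) (auto simp: E_def)
  have bound: "Poly_Mapping.lookup m i \<le> e" if "m \<in> Poly_Mapping.keys p" for m i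
  proof -
    have "(\<Sum>es\<in>E. c es * Poly_Mapping.lookup (power_product as es) m) \<noteq> 0"
      using that by (simp add: in_keys_iff lookup)
    then obtain es where "es \<in> E" "c es * Poly_Mapping.lookup (power_product as es) m \<noteq> 0"
      by (rule sum.not_neutral_contains_not_neutral)
    then show ?thesis using le[of es] by (simp add: exponents_le_def in_keys_iff)
  qed
  have "p \<in> carrier (poly_ring n)"
    unfolding p_def using len as
    by (intro poly_ring_sum_closed poly_ring_closed power_product_closed single_in_poly_ring) auto
  moreover have "\<not> Poly_Mapping.keys m \<subseteq> T" if "m \<in> Poly_Mapping.keys p" for m
  proof
    assume "Poly_Mapping.keys m \<subseteq> T"
    then have "Poly_Mapping.lookup p m = 0" unfolding lookup using bound[OF that] by (intro rel) simp
    with that show False by (simp add: in_keys_iff)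
  qed
  ultimately have "p \<in> mono_ideal n (\<lambda>m. \<not> Poly_Mapping.keys m \<subseteq> T)"
    by (simp add: mono_ideal_def)
  moreover have "finite A" "A \<noteq> {}" using c fin(1) by (auto simp: A_def)
  moreover have "c es \<noteq> 0" if "es \<in> A" for es using that by (simp add: A_def)
  ultimately show thesis using len unfolding p_def by (intro that[of A c]) blast+
qed

text \<open>
  Read the relation from its lexicographically lowest term: cancelling the lowest power of the
  first element and reducing modulo the next ideal removes that element from the relation.
\<close>

lemma one_mem_of_relation:
  fixes as :: "'k::field mpoly list"
  assumes "\<And>i. i \<le> length as \<Longrightarrow> ideal (J i) (poly_ring n)"
    and "\<And>i. i < length as \<Longrightarrow> J i \<subseteq> J (Suc i) \<and> as ! i \<in> J (Suc i)"
    and "\<And>i y. i < length as \<Longrightarrow> y \<in> carrier (poly_ring n) \<Longrightarrow> as ! i * y \<in> J i \<Longrightarrow> y \<in> J i"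
    and "set as \<subseteq> carrier (poly_ring n)"
    and "finite A" "A \<noteq> {}" "\<And>es. es \<in> A \<Longrightarrow> length es = length as"
    and "\<And>es. es \<in> A \<Longrightarrow> c es \<noteq> 0"
    and "(\<Sum>es\<in>A. Poly_Mapping.single 0 (c es) * power_product as es) \<in> J 0"
  shows "1 \<in> J (length as)"
  using assms
proof (induction as arbitrary: J A c)
  \<comment> \<open>With no element left the relation is a single nonzero constant, which a field
    can invert.\<close>
  case Nil
  from Nil(6,7) have A: "A = {[]}" by auto
  have "Poly_Mapping.single 0 (inverse (c [])) \<in> carrier (poly_ring n)"
    by (rule single_in_poly_ring) simp
  moreover have "Poly_Mapping.single 0 (c []) \<in> J 0" using Nil(9) by (simp add: A)
  ultimately have "Poly_Mapping.single 0 (inverse (c [])) * Poly_Mapping.single 0 (c []) \<in> J 0"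
    using poly_ring_idealD(4)[OF Nil(1)[of 0]] by simp
  then show ?case using Nil(8)[of "[]"] by (simp add: A mult_single)
next
  case (Cons a as)
  note fin = Cons.prems(5) and ne = Cons.prems(6) and len = Cons.prems(7)
  have a: "a \<in> carrier (poly_ring n)" using Cons.prems(4) by simp
  have as: "set as \<subseteq> carrier (poly_ring n)" using Cons.prems(4) by simp
  define e where "e = Min (hd ` A)"
  define L where "L = {es\<in>A. hd es = e}"
  define t where "t es = Poly_Mapping.single 0 (c es) * power_product as (tl es)" for es
  have min: "e \<le> hd es" if "es \<in> A" for es using that fin by (simp add: e_def)
  have shape: "es = hd es # tl es" "length (tl es) = length as" if "es \<in> A" for es
    using len[OF that] by (cases es; simp)+
  have t_closed: "t es \<in> carrier (poly_ring n)" if "es \<in> A" for es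
    unfolding t_def using shape[OF that] as
    by (intro poly_ring_closed single_in_poly_ring power_product_closed) auto
  \<comment> \<open>The terms above the lowest exponent, after removal of a^e and one further factor
    \<open>a\<close>. Outside \<open>L\<close> the head exceeds \<open>e\<close>, so the subtraction
    is exact; the product a s then lies in the next ideal and drops out.\<close>
  define s where "s = (\<Sum>es\<in>A - L. a ^ (hd es - Suc e) * t es)"
  have s: "s \<in> carrier (poly_ring n)"
    unfolding s_def
    by (intro poly_ring_sum_closed poly_ring_closed poly_ring_closed_power a t_closed) auto
  have term_eq: "Poly_Mapping.single 0 (c es) * power_product (a # as) es = a ^ hd es * t es" if "es \<in> A" for es
    by (subst shape(1)[OF that]) (simp add: t_def algebra_simps)
  have "(\<Sum>es\<in>A. Poly_Mapping.single 0 (c es) * power_product (a # as) es)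
      = (\<Sum>es\<in>A. a ^ hd es * t es)"
    by (rule sum.cong) (auto simp: term_eq)
  also have "\<dots> = (\<Sum>es\<in>L. a ^ hd es * t es) + (\<Sum>es\<in>A - L. a ^ hd es * t es)"
    using fin by (subst sum.subset_diff[of L A]) (auto simp: L_def)
  also have "(\<Sum>es\<in>L. a ^ hd es * t es) = a ^ e * (\<Sum>es\<in>L. t es)"
    unfolding sum_distrib_left by (rule sum.cong) (auto simp: L_def)
  also have "(\<Sum>es\<in>A - L. a ^ hd es * t es) = a ^ e * (a * s)"
    unfolding s_def sum_distrib_left
  proof (rule sum.cong)
    fix es assume "es \<in> A - L"
    then have "hd es = e + Suc (hd es - Suc e)" using min[of es] by (auto simp: L_def)
    then have "a ^ hd es = a ^ e * (a * a ^ (hd es - Suc e))" by (metis power_Suc power_add)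
    then show "a ^ hd es * t es = a ^ e * (a * (a ^ (hd es - Suc e) * t es))"
      by (simp only: mult.assoc)
  qed simp
  finally have "(\<Sum>es\<in>A. Poly_Mapping.single 0 (c es) * power_product (a # as) es)
      = a ^ e * ((\<Sum>es\<in>L. t es) + a * s)"
    by (simp only: distrib_left)
  then have "a ^ e * ((\<Sum>es\<in>L. t es) + a * s) \<in> J 0" using Cons.prems(9) by simp
  moreover have "(\<Sum>es\<in>L. t es) + a * s \<in> carrier (poly_ring n)"
    using a s by (intro poly_ring_closed poly_ring_sum_closed) (auto simp: L_def t_closed)
  moreover have "y \<in> J 0" if "y \<in> carrier (poly_ring n)" "a * y \<in> J 0" for y
    using Cons.prems(3)[of 0 y] that by simp
  ultimately have "(\<Sum>es\<in>L. t es) + a * s \<in> J 0"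
    using a by (blast intro: cancel_power)
  then have "(\<Sum>es\<in>L. t es) + a * s \<in> J (Suc 0)" using Cons.prems(2)[of 0] by auto
  moreover have ideal1: "ideal (J (Suc 0)) (poly_ring n)" using Cons.prems(1)[of "Suc 0"] by simp
  moreover have "a * s \<in> J (Suc 0)"
    using poly_ring_idealD(5)[OF ideal1 s] Cons.prems(2)[of 0] by simp
  ultimately have "(\<Sum>es\<in>L. t es) \<in> J (Suc 0)"
    using poly_ring_idealD(7)[OF ideal1] by (metis add_diff_cancel_right')
  \<comment> \<open>All heads in \<open>L\<close> equal \<open>e\<close>, so no two terms merge when
    the head is removed, and the coefficients of the shortened relation remain nonzero.\<close>
  moreover have inj: "inj_on tl L"
    by (rule inj_onI) (metis (mono_tags, lifting) L_def mem_Collect_eq shape(1))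
  have "(\<Sum>es\<in>L. t es) =
    (\<Sum>es\<in>tl ` L. Poly_Mapping.single 0 (c (e # es)) * power_product as es)"
    unfolding sum.reindex[OF inj] o_def
  proof (rule sum.cong)
    fix es assume "es \<in> L"
    then have "es \<in> A" "hd es = e" by (auto simp: L_def)
    then have "e # tl es = es" using shape(1) by metis
    then show "t es = Poly_Mapping.single 0 (c (e # tl es)) * power_product as (tl es)"
      by (simp add: t_def)
  qed simp
  ultimately have rel: "(\<Sum>es\<in>tl ` L. Poly_Mapping.single 0 (c (e # es)) * power_product as es) \<in> J (Suc 0)"
    by simp
  have "e \<in> hd ` A" unfolding e_def using fin ne by (intro Min_in) auto
  then have L_ne: "L \<noteq> {}" by (auto simp: L_def)
  have "1 \<in> J (Suc (length as))"
  proof (rule Cons.IH[of "\<lambda>i. J (Suc i)" "tl ` L" "\<lambda>es. c (e # es)", OF _ _ _ as _ _ _ _ rel])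
    show "finite (tl ` L)" using fin by (simp add: L_def)
    show "tl ` L \<noteq> {}" using L_ne by simp
    fix es assume "es \<in> tl ` L"
    then obtain fs where fs: "es = tl fs" "fs \<in> A" "hd fs = e" by (auto simp: L_def)
    then show "length es = length as" using shape(2) by simp
    have "e # es = fs" using fs shape(1) by metis
    then show "c (e # es) \<noteq> 0" using Cons.prems(8) fs(2) by simp
  qed (use Cons.prems(1,2,3)[of "Suc _"] in auto)
  then show ?case by simp
qed

lemma one_mem_of_chain:
  fixes as :: "'k::field mpoly list"
  assumes "finite T" "card T < length as" and as: "set as \<subseteq> carrier (poly_ring n)"
    and J: "\<And>i. i \<le> length as \<Longrightarrow> ideal (J i) (poly_ring n)"
    and step: "\<And>i. i < length as \<Longrightarrow> J i \<subseteq> J (Suc i) \<and> as ! i \<in> J (Suc i)"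
    and cancel: "\<And>i y. i < length as \<Longrightarrow> y \<in> carrier (poly_ring n) \<Longrightarrow> as ! i * y \<in> J i \<Longrightarrow> y \<in> J i"
    and "mono_ideal n (\<lambda>m. \<not> Poly_Mapping.keys m \<subseteq> T) \<subseteq> J 0"
  shows "1 \<in> J (length as)"
proof -
  obtain A c where "finite A" "A \<noteq> {}" "\<And>es. es \<in> A \<Longrightarrow> length es = length as"
    "\<And>es. es \<in> A \<Longrightarrow> c es \<noteq> 0"
    "(\<Sum>es\<in>A. Poly_Mapping.single 0 (c es) * power_product as es)
      \<in> mono_ideal n (\<lambda>m. \<not> Poly_Mapping.keys m \<subseteq> T)"
    using exists_algebraic_relation[OF assms(1-3)] by blast
  then show ?thesis
    using one_mem_of_relation[OF J step cancel as, of A c] assms(7) by blast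
qed

section \<open>Prime monomial ideals\<close>

text \<open>The substitution of 0 for all variables outside \<open>T\<close>. It is written as a
  filter on terms so that its values are again of type \<open>'k mpoly\<close>.\<close>

definition restrict_vars :: "nat set \<Rightarrow> 'k::comm_ring_1 mpoly \<Rightarrow> 'k mpoly" where
  "restrict_vars T p = Poly_Mapping.mapp (\<lambda>m c. c when Poly_Mapping.keys m \<subseteq> T) p"

lemma lookup_restrict_vars:
  "Poly_Mapping.lookup (restrict_vars T p) m = (Poly_Mapping.lookup p m when Poly_Mapping.keys m \<subseteq> T)"
  by (simp add: restrict_vars_def lookup_mapp when_def in_keys_iff)

lemma restrict_vars_add: "restrict_vars T (p + q) = restrict_vars T p + restrict_vars T q"
  by (rule poly_mapping_eqI) (simp add: lookup_restrict_vars lookup_add when_def)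

lemma restrict_vars_diff: "restrict_vars T (p - q) = restrict_vars T p - restrict_vars T q"
  by (rule poly_mapping_eqI) (simp add: lookup_restrict_vars lookup_minus when_def)

lemma restrict_vars_eq_0_iff:
  "restrict_vars T p = 0 \<longleftrightarrow> (\<forall>m\<in>Poly_Mapping.keys p. \<not> Poly_Mapping.keys m \<subseteq> T)"
  by (auto simp: poly_mapping_eq_iff fun_eq_iff lookup_restrict_vars when_def in_keys_iff)

lemma restrict_vars_idem_iff:
  "restrict_vars T p = p \<longleftrightarrow> (\<forall>m\<in>Poly_Mapping.keys p. Poly_Mapping.keys m \<subseteq> T)"
  by (auto simp: poly_mapping_eq_iff fun_eq_iff lookup_restrict_vars when_def in_keys_iff)

lemma keys_restrict_vars:
  "Poly_Mapping.keys (restrict_vars T p) = {m\<in>Poly_Mapping.keys p. Poly_Mapping.keys m \<subseteq> T}"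
proof (rule Set.set_eqI)
  fix m
  show "m \<in> Poly_Mapping.keys (restrict_vars T p) \<longleftrightarrow>
      m \<in> {m\<in>Poly_Mapping.keys p. Poly_Mapping.keys m \<subseteq> T}"
    by (cases "Poly_Mapping.keys m \<subseteq> T") (simp_all add: in_keys_iff[of m] lookup_restrict_vars)
qed

text \<open>Split each factor into its part over \<open>T\<close> and the rest: terms that leave
  \<open>T\<close> absorb products, and terms within \<open>T\<close> are closed under
  products.\<close>

lemma restrict_vars_mult: "restrict_vars T (p * q) = restrict_vars T p * restrict_vars T q"
proof -
  have zero: "restrict_vars T (p * q) = 0" if "restrict_vars T p = 0" for p q :: "'a mpoly"
    unfolding restrict_vars_eq_0_iff
  proof
    fix m assume "m \<in> Poly_Mapping.keys (p * q)"
    then obtain a b where "m = a + b" "a \<in> Poly_Mapping.keys p"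
      using Poly_Mapping.keys_mult[of p q] by blast
    then show "\<not> Poly_Mapping.keys m \<subseteq> T"
      using that by (auto simp: restrict_vars_eq_0_iff keys_plus_nat)
  qed
  let ?p = "restrict_vars T p" and ?q = "restrict_vars T q"
  have idem: "restrict_vars T ?p = ?p" "restrict_vars T ?q = ?q"
    by (auto simp: restrict_vars_idem_iff keys_restrict_vars)
  have prod: "restrict_vars T (?p * ?q) = ?p * ?q"
    unfolding restrict_vars_idem_iff
  proof
    fix m assume "m \<in> Poly_Mapping.keys (?p * ?q)"
    then obtain a b where "m = a + b" "a \<in> Poly_Mapping.keys ?p" "b \<in> Poly_Mapping.keys ?q"
      using Poly_Mapping.keys_mult[of ?p ?q] by blast
    then show "Poly_Mapping.keys m \<subseteq> T"
      by (auto simp: keys_restrict_vars keys_plus_nat)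
  qed
  have "p * q = (p - ?p) * q + ((q - ?q) * ?p + ?p * ?q)" by (simp add: algebra_simps)
  then have "restrict_vars T (p * q) = restrict_vars T ((p - ?p) * q) +
      (restrict_vars T ((q - ?q) * ?p) + restrict_vars T (?p * ?q))"
    by (simp only: restrict_vars_add)
  then show ?thesis
    by (simp add: zero restrict_vars_diff idem prod)
qed

abbreviation outside_ideal :: "nat \<Rightarrow> nat set \<Rightarrow> 'k::comm_ring_1 mpoly set" where
  "outside_ideal n T \<equiv> mono_ideal n (\<lambda>m. \<not> Poly_Mapping.keys m \<subseteq> T)"

lemma outside_ideal_iff:
  "p \<in> outside_ideal n T \<longleftrightarrow> p \<in> carrier (poly_ring n) \<and> restrict_vars T p = 0"
  by (simp add: mono_ideal_def restrict_vars_eq_0_iff)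

text \<open>The ideal is the kernel of the substitution \<open>restrict_vars T\<close>, whose values
  lie in a domain.\<close>

lemma outside_ideal_prime: "primeideal (outside_ideal n T :: 'k::field mpoly set) (poly_ring n)"
proof (rule primeidealI)
  show "ideal (outside_ideal n T) (poly_ring n)"
    by (rule mono_ideal_ideal) (auto simp: keys_plus_nat)
  show "cring (poly_ring n)" by (rule poly_ring_cring)
  have "(1 :: 'k mpoly) \<notin> outside_ideal n T" by (simp add: mono_ideal_def)
  then show "carrier (poly_ring n) \<noteq> (outside_ideal n T :: 'k mpoly set)"
    using poly_ring_closed_const(2) by blast
qed (simp add: outside_ideal_iff restrict_vars_mult)

lemma X_outside_ideal_iff:
  "i \<in> {1..n} \<Longrightarrow> X i \<in> outside_ideal n T \<longleftrightarrow> i \<notin> T"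
  by (simp add: mono_ideal_def X_def poly_ring_def)

lemma outside_ideal_antimono: "T \<subseteq> T' \<Longrightarrow> outside_ideal n T' \<subseteq> outside_ideal n T"
  by (auto simp: mono_ideal_def)

lemma single_eq_X_mult:
  assumes "i \<in> Poly_Mapping.keys m"
  shows "Poly_Mapping.single m c = X i * Poly_Mapping.single (m - Poly_Mapping.single i 1) c"
proof -
  have "m = Poly_Mapping.single i 1 + (m - Poly_Mapping.single i 1)"
    by (rule poly_mapping_eqI)
      (use assms in \<open>auto simp: lookup_add lookup_minus lookup_single when_def in_keys_iff\<close>)
  then show ?thesis by (simp add: X_def mult_single)
qed

lemma keys_diff_subset: "Poly_Mapping.keys (m - m' :: nat \<Rightarrow>\<^sub>0 nat) \<subseteq> Poly_Mapping.keys m"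
  by (auto simp: in_keys_iff lookup_minus)

lemma outside_ideal_subset:
  fixes J :: "'k::comm_ring_1 mpoly set"
  assumes J: "ideal J (poly_ring n)" and "\<And>i. i \<in> {1..n} - T \<Longrightarrow> X i \<in> J"
  shows "outside_ideal n T \<subseteq> J"
proof (rule mono_ideal_subsetI[OF J])
  fix m :: "nat \<Rightarrow>\<^sub>0 nat" and c :: 'k assume m: "Poly_Mapping.keys m \<subseteq> {1..n}" "\<not> Poly_Mapping.keys m \<subseteq> T"
  then obtain i where i: "i \<in> Poly_Mapping.keys m" "i \<notin> T" by blast
  have "Poly_Mapping.single (m - Poly_Mapping.single i 1) c \<in> carrier (poly_ring n)"
    using m(1) keys_diff_subset by (intro single_in_poly_ring) blast
  then show "Poly_Mapping.single m c \<in> J"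
    unfolding single_eq_X_mult[OF i(1)] using assms(2) i m(1) poly_ring_idealD(5)[OF J] by blast
qed

section \<open>Krull dimension\<close>

lemma krull_dim_Quot_ge:
  fixes I :: "'k::field mpoly set"
  assumes I: "ideal I (poly_ring n)" and F: "F \<subseteq> {1..n}" "I \<subseteq> outside_ideal n F"
  shows "enat (card F) \<le> krull_dim (poly_ring n Quot I)"
proof -
  interpret S: cring "poly_ring n :: 'k mpoly ring" by (rule poly_ring_cring)
  let ?h = "(+>\<^bsub>poly_ring n\<^esub>) I"
  obtain xs where xs: "set xs = F" "distinct xs"
    using finite_distinct_list[OF finite_subset[OF F(1)]] by auto
  \<comment> \<open>Listing \<open>F\<close> turns its subsets into a chain: each further dropped
    entry is one more variable in the prime, and that variable witnesses strictness.\<close>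
  define P where "P i = ?h ` outside_ideal n (set (drop i xs))" for i
  have sub: "I \<subseteq> outside_ideal n (set (drop i xs))" for i
    using F(2) outside_ideal_antimono[of "set (drop i xs)" F n] set_drop_subset[of i xs] xs(1) by blast
  have "P i \<subset> P (Suc i)" if i: "i < length xs" for i
  proof
    have drop: "drop i xs = xs ! i # drop (Suc i) xs" using Cons_nth_drop_Suc[OF i] by simp
    then show "P i \<subseteq> P (Suc i)"
      unfolding P_def by (intro image_mono outside_ideal_antimono) auto
    have "distinct (xs ! i # drop (Suc i) xs)"
      using distinct_drop[OF xs(2), of i] drop by simp
    then have "xs ! i \<notin> set (drop (Suc i) xs)" by simp
    moreover have v: "xs ! i \<in> {1..n}" using nth_mem[OF i] xs(1) F(1) by blast
    ultimately have "(X (xs ! i) :: 'k mpoly) \<in> outside_ideal n (set (drop (Suc i) xs))"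
      "(X (xs ! i) :: 'k mpoly) \<notin> outside_ideal n (set (drop i xs))"
      unfolding X_outside_ideal_iff[OF v] drop by simp_all
    moreover have "?h (X (xs ! i)) \<in> P k \<longleftrightarrow>
        (X (xs ! i) :: 'k mpoly) \<in> outside_ideal n (set (drop k xs))" for k
      unfolding P_def
      by (rule S.rcos_mem_image_iff[OF I primeideal.axioms(1)[OF outside_ideal_prime] sub X_in_carrier[OF v]])
    ultimately show "P i \<noteq> P (Suc i)" by blast
  qed
  moreover have "primeideal (P i) (poly_ring n Quot I)" for i
    unfolding P_def by (rule S.primeideal_Quot_image[OF I outside_ideal_prime sub])
  moreover have "length xs = card F" using distinct_card[OF xs(2)] xs(1) by simp
  ultimately show ?thesis
    unfolding krull_dim_def by (intro Sup_upper CollectI exI[of _ "card F"] conjI refl exI[of _ P]) auto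
qed

text \<open>Lift a chain to primes \<open>Q i\<close> of the polynomial ring. All variables outside
  T = {i. X i \<notin> Q 0} lie in \<open>Q 0\<close>, so if the chain were longer than |T|, the
  elements \<open>a i\<close> chosen from the successive differences would be dependent modulo
  \<open>Q 0\<close> and would force 1 into the top prime.\<close>

lemma krull_dim_Quot_le:
  fixes I :: "'k::field mpoly set"
  assumes I: "ideal I (poly_ring n)"
    and card: "\<And>Q. primeideal Q (poly_ring n) \<Longrightarrow> I \<subseteq> Q \<Longrightarrow> card {i\<in>{1..n}. X i \<notin> Q} \<le> d"
  shows "krull_dim (poly_ring n Quot I) \<le> enat d"
  unfolding krull_dim_def
proof (rule Sup_least)
  interpret S: cring "poly_ring n :: 'k mpoly ring" by (rule poly_ring_cring)
  interpret I: ideal I "poly_ring n" by (rule I)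
  let ?R = "poly_ring n Quot I"
  let ?h = "(+>\<^bsub>poly_ring n\<^esub>) I"
  have carr: "carrier ?R = ?h ` carrier (poly_ring n)"
    unfolding FactRing_def A_RCOSETS_def' by auto
  fix x assume "x \<in> {enat d | d. \<exists>P. (\<forall>i\<le>d. primeideal (P i) ?R) \<and> (\<forall>i<d. P i \<subset> P (Suc i))}"
  then obtain e P where x: "x = enat e" and P: "\<And>i. i \<le> e \<Longrightarrow> primeideal (P i) ?R"
    "\<And>i. i < e \<Longrightarrow> P i \<subset> P (Suc i)" by blast
  define Q where "Q i = {a \<in> carrier (poly_ring n). ?h a \<in> P i}" for i
  have Q: "primeideal (Q i) (poly_ring n)" if "i \<le> e" for i
    unfolding Q_def by (rule S.primeideal_Quot_vimage[OF I P(1)[OF that]])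
  have "\<exists>a. a \<in> Q (Suc i) \<and> a \<notin> Q i" if i: "i < e" for i
  proof -
    obtain y where y: "y \<in> P (Suc i)" "y \<notin> P i" using P(2)[OF i] by blast
    have "primeideal (P (Suc i)) ?R" using P(1) i by simp
    then have "y \<in> carrier ?R"
      using y(1) additive_subgroup.a_subset ideal.axioms(1) primeideal.axioms(1) by blast
    then obtain a where "a \<in> carrier (poly_ring n)" "y = ?h a" unfolding carr by blast
    then show ?thesis using y by (auto simp: Q_def)
  qed
  then obtain a where a: "\<And>i. i < e \<Longrightarrow> a i \<in> Q (Suc i) \<and> a i \<notin> Q i" by metis
  let ?T = "{i\<in>{1..n}. X i \<notin> Q 0}"
  let ?as = "map a [0..<e]"
  have "I \<subseteq> Q 0"
  proof
    fix p assume p: "p \<in> I"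
    have "primeideal (P 0) ?R" using P(1) by simp
    then have "\<zero>\<^bsub>?R\<^esub> \<in> P 0"
      using additive_subgroup.zero_closed ideal.axioms(1) primeideal.axioms(1) by blast
    then have "?h p \<in> P 0" using S.a_rcos_zero[OF I p] by (simp add: FactRing_def)
    then show "p \<in> Q 0" using p I.a_subset by (auto simp: Q_def)
  qed
  then have "card ?T \<le> d" using card[OF Q[of 0]] by simp
  moreover have "\<not> card ?T < e"
  proof
    assume less: "card ?T < e"
    have "1 \<in> Q (length ?as)"
    proof (rule one_mem_of_chain)
      show "outside_ideal n ?T \<subseteq> Q 0"
        by (rule outside_ideal_subset[OF primeideal.axioms(1)[OF Q]]) auto
      show "ideal (Q i) (poly_ring n)" if "i \<le> length ?as" for i
        using primeideal.axioms(1)[OF Q[of i]] that by simp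
      show "set ?as \<subseteq> carrier (poly_ring n)" using a by (auto simp: Q_def)
      show "Q i \<subseteq> Q (Suc i) \<and> ?as ! i \<in> Q (Suc i)" if "i < length ?as" for i
        using that P(2)[of i] a[of i] by (auto simp: Q_def)
      show "y \<in> Q i" if i: "i < length ?as" and y: "y \<in> carrier (poly_ring n)" "?as ! i * y \<in> Q i" for i y
        using primeideal.I_prime[OF Q, of i "a i" y] a[of i] that by (auto simp: Q_def)
    qed (use less in auto)
    then have "1 \<in> Q e" by simp
    then have "carrier (poly_ring n) = Q e"
      using ideal.one_imp_carrier[OF primeideal.axioms(1)[OF Q[of e]]] by simp
    then show False using primeideal.I_notcarr[OF Q[of e]] by simp
  qed
  ultimately show "x \<le> enat d" using x by simp
qed

section \<open>Depth\<close>

lemma foldl_adjoin_ideal: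
  assumes "ideal B (poly_ring n)" "set as \<subseteq> carrier (poly_ring n)"
  shows "ideal (foldl (adjoin n) B as) (poly_ring n)"
  using assms by (induction as arbitrary: B) (auto intro: adjoin_ideal)

lemma foldl_adjoin_supset:
  assumes "ideal B (poly_ring n)" "set as \<subseteq> carrier (poly_ring n)"
  shows "B \<union> set as \<subseteq> foldl (adjoin n) B as"
  using assms
proof (induction as arbitrary: B)
  case (Cons a as)
  have "adjoin n B a \<union> set as \<subseteq> foldl (adjoin n) B (a # as)"
    using Cons.IH[of "adjoin n B a"] Cons.prems adjoin_ideal[OF Cons.prems(1), of a] by simp
  then show ?case using adjoin_supset[of B n a] adjoin_self[OF Cons.prems(1), of a] by auto
qed simp

lemma foldl_adjoin_least:
  assumes "ideal J (poly_ring n)" "B \<subseteq> J" "set as \<subseteq> J"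
  shows "foldl (adjoin n) B as \<subseteq> J"
  using assms(2,3)
proof (induction as arbitrary: B)
  case (Cons a as)
  then have "adjoin n B a \<subseteq> J" by (intro adjoin_least[OF assms(1)]) auto
  with Cons show ?case by simp
qed simp

lemma regular_mod_iff_nth:
  "regular_mod n B as \<longleftrightarrow> (\<forall>i<length as. \<forall>y\<in>carrier (poly_ring n).
     as ! i * y \<in> foldl (adjoin n) B (take i as) \<longrightarrow> y \<in> foldl (adjoin n) B (take i as))"
proof (induction as arbitrary: B)
  case (Cons a as)
  show ?case
    unfolding regular_mod.simps(2) Cons.IH length_Cons All_less_Suc2 by simp
qed simp

lemma genideal_Quot_image:
  fixes I :: "'k::field mpoly set"
  assumes I: "ideal I (poly_ring n)" and as: "set as \<subseteq> carrier (poly_ring n)"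
  shows "Idl\<^bsub>poly_ring n Quot I\<^esub> (set (map ((+>\<^bsub>poly_ring n\<^esub>) I) as)) =
    (+>\<^bsub>poly_ring n\<^esub>) I ` foldl (adjoin n) I as"
proof -
  interpret S: cring "poly_ring n :: 'k mpoly ring" by (rule poly_ring_cring)
  interpret I: ideal I "poly_ring n" by (rule I)
  let ?R = "poly_ring n Quot I"
  let ?h = "(+>\<^bsub>poly_ring n\<^esub>) I"
  let ?D = "foldl (adjoin n) I as"
  interpret h: ring_hom_ring "poly_ring n" ?R ?h by (rule I.rcos_ring_hom_ring)
  have D: "ideal ?D (poly_ring n)" by (rule foldl_adjoin_ideal[OF I as])
  note sup = foldl_adjoin_supset[OF I as]
  have gen: "set (map ?h as) \<subseteq> carrier ?R"
    using as h.hom_closed by auto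
  show ?thesis
  proof
    show "Idl\<^bsub>?R\<^esub> (set (map ?h as)) \<subseteq> ?h ` ?D"
      by (rule h.S.genideal_minimal[OF S.ring_ideal_imp_quot_ideal[OF I D]]) (use sup in auto)
    have ideal: "ideal (Idl\<^bsub>?R\<^esub> (set (map ?h as))) ?R" by (rule h.S.genideal_ideal[OF gen])
    have "?D \<subseteq> {a \<in> carrier (poly_ring n). ?h a \<in> Idl\<^bsub>?R\<^esub> (set (map ?h as))}"
    proof (rule foldl_adjoin_least[OF h.ideal_vimage[OF ideal]])
      show "set as \<subseteq> {a \<in> carrier (poly_ring n). ?h a \<in> Idl\<^bsub>?R\<^esub> (set (map ?h as))}"
        using h.S.genideal_self[OF gen] as by auto
      have "\<zero>\<^bsub>?R\<^esub> \<in> Idl\<^bsub>?R\<^esub> (set (map ?h as))"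
        by (rule additive_subgroup.zero_closed[OF ideal.axioms(1)[OF ideal]])
      then show "I \<subseteq> {a \<in> carrier (poly_ring n). ?h a \<in> Idl\<^bsub>?R\<^esub> (set (map ?h as))}"
        using S.a_rcos_zero[OF I] I.a_subset by (auto simp: FactRing_def)
    qed
    then show "?h ` ?D \<subseteq> Idl\<^bsub>?R\<^esub> (set (map ?h as))" by blast
  qed
qed

text \<open>The passage from cosets to representatives: afterwards depth is treated entirely by
  ideals of the polynomial ring that contain \<open>I\<close>.\<close>

lemma regular_sequence_Quot_iff:
  fixes I :: "'k::field mpoly set"
  assumes I: "ideal I (poly_ring n)" and as: "set as \<subseteq> carrier (poly_ring n)"
  shows "regular_sequence (poly_ring n Quot I) (map ((+>\<^bsub>poly_ring n\<^esub>) I) as) \<longleftrightarrow>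
    regular_mod n I as \<and> 1 \<notin> foldl (adjoin n) I as"
proof -
  interpret S: cring "poly_ring n :: 'k mpoly ring" by (rule poly_ring_cring)
  interpret I: ideal I "poly_ring n" by (rule I)
  let ?R = "poly_ring n Quot I"
  let ?h = "(+>\<^bsub>poly_ring n\<^esub>) I"
  let ?D = "\<lambda>i. foldl (adjoin n) I (take i as)"
  interpret h: ring_hom_ring "poly_ring n" ?R ?h by (rule I.rcos_ring_hom_ring)
  have carr: "carrier ?R = ?h ` carrier (poly_ring n)"
    unfolding FactRing_def A_RCOSETS_def' by auto
  have take_as: "set (take i as) \<subseteq> carrier (poly_ring n)" for i
    using as set_take_subset by fast
  have D: "ideal (?D i) (poly_ring n)" "I \<subseteq> ?D i" for i
    using foldl_adjoin_ideal[OF I take_as] foldl_adjoin_supset[OF I take_as] by blast+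
  have mem: "?h a \<in> ?h ` ?D i \<longleftrightarrow> a \<in> ?D i" if "a \<in> carrier (poly_ring n)" for a i
    by (rule S.rcos_mem_image_iff[OF I D that])
  have nzd: "nonzerodivisor (?R Quot (?h ` ?D i)) ((?h ` ?D i) +>\<^bsub>?R\<^esub> ?h (as ! i)) \<longleftrightarrow>
      (\<forall>y\<in>carrier (poly_ring n). as ! i * y \<in> ?D i \<longrightarrow> y \<in> ?D i)" if i: "i < length as" for i
  proof -
    have a: "as ! i \<in> carrier (poly_ring n)" using i as by auto
    have mult: "?h (as ! i) \<otimes>\<^bsub>?R\<^esub> ?h y = ?h (as ! i * y)" if "y \<in> carrier (poly_ring n)" for y
      using h.hom_mult[OF a that] by simp
    show ?thesis
      using nonzerodivisor_Quot_iff[OF S.ring_ideal_imp_quot_ideal[OF I D(1)], of "?h (as ! i)" i] a i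
      by (simp add: carr mult mem poly_ring_closed)
  qed
  have idl: "Idl\<^bsub>?R\<^esub> (set (take i (map ?h as))) = ?h ` ?D i" for i
    unfolding take_map by (rule genideal_Quot_image[OF I take_as])
  have "Idl\<^bsub>?R\<^esub> (set (map ?h as)) \<noteq> carrier ?R \<longleftrightarrow> 1 \<notin> foldl (adjoin n) I as"
  proof -
    have "Idl\<^bsub>?R\<^esub> (set (map ?h as)) = ?h ` ?D (length as)"
      using genideal_Quot_image[OF I as] by simp
    moreover have "?h ` ?D (length as) = carrier ?R \<longleftrightarrow> 1 \<in> ?D (length as)"
    proof
      assume "?h ` ?D (length as) = carrier ?R"
      then have "?h 1 \<in> ?h ` ?D (length as)" unfolding carr by simp
      then show "1 \<in> ?D (length as)" using mem[of 1 "length as"] by simp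
    next
      assume "1 \<in> ?D (length as)"
      then have "?D (length as) = carrier (poly_ring n)"
        using ideal.one_imp_carrier[OF D(1)[of "length as"]] by simp
      then show "?h ` ?D (length as) = carrier ?R" unfolding carr by simp
    qed
    ultimately show ?thesis by simp
  qed
  moreover have "set (map ?h as) \<subseteq> carrier ?R" using as h.hom_closed by auto
  ultimately show ?thesis
    unfolding regular_sequence_def regular_mod_iff_nth Let_def idl by (simp add: nzd)
qed

section \<open>Degrees, and the bound on the depth by the size of a facet\<close>

definition total_degree :: "nat \<Rightarrow> (nat \<Rightarrow>\<^sub>0 nat) \<Rightarrow> nat" where
  "total_degree n m = (\<Sum>i\<in>{1..n}. Poly_Mapping.lookup m i)"

lemma total_degree_add: "total_degree n (m + m') = total_degree n m + total_degree n m'"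
  by (simp add: total_degree_def lookup_add sum.distrib)

lemma irrelevant_ideal_subset: "irrelevant_ideal n \<subseteq> mono_ideal n (\<lambda>m. 1 \<le> total_degree n m)"
proof -
  interpret S: cring "poly_ring n :: 'a mpoly ring" by (rule poly_ring_cring)
  show ?thesis
    unfolding irrelevant_ideal_def
  proof (rule S.genideal_minimal)
    show "ideal (mono_ideal n (\<lambda>m. 1 \<le> total_degree n m)) (poly_ring n)"
      by (rule mono_ideal_ideal) (simp add: total_degree_add)
    have "1 \<le> total_degree n (Poly_Mapping.single i 1)" if "i \<in> {1..n}" for i
      unfolding total_degree_def using that by (subst sum.remove[of _ i]) (simp_all add: lookup_single)
    then show "X ` {1..n} \<subseteq> mono_ideal n (\<lambda>m. 1 \<le> total_degree n m)"
      by (auto simp: mono_ideal_def X_def poly_ring_def)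
  qed
qed

lemma mono_ideal_power:
  assumes "p \<in> mono_ideal n (\<lambda>m. 1 \<le> total_degree n m)"
  shows "p ^ k \<in> mono_ideal n (\<lambda>m. k \<le> total_degree n m)"
proof (induction k)
  case 0
  show ?case by (simp add: mono_ideal_def)
next
  case (Suc k)
  show ?case
    unfolding power_Suc by (rule mono_ideal_mult[OF assms Suc]) (simp add: total_degree_add)
qed

definition indicator_exponent :: "nat set \<Rightarrow> nat \<Rightarrow>\<^sub>0 nat" where
  "indicator_exponent F = (\<Sum>i\<in>F. Poly_Mapping.single i 1)"

lemma lookup_indicator_exponent:
  "finite F \<Longrightarrow> Poly_Mapping.lookup (indicator_exponent F) i = (if i \<in> F then 1 else 0)"
  by (simp add: indicator_exponent_def lookup_sum lookup_single when_def)

lemma keys_indicator_exponent: "finite F \<Longrightarrow> Poly_Mapping.keys (indicator_exponent F) = F"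
  by (auto simp: in_keys_iff lookup_indicator_exponent split: if_splits)

lemma total_degree_indicator_exponent:
  assumes "F \<subseteq> {1..n}"
  shows "total_degree n (indicator_exponent F) = card F"
proof -
  have fin: "finite F" using assms finite_subset by blast
  have "total_degree n (indicator_exponent F) = (\<Sum>i\<in>{1..n}. if i \<in> F then 1 else 0)"
    by (simp add: total_degree_def lookup_indicator_exponent[OF fin])
  also have "\<dots> = card ({1..n} \<inter> F)" by (simp add: sum.If_cases)
  finally show ?thesis using assms by (simp add: Int_absorb1)
qed

text \<open>
  The monomial $x_F = \prod_{i \in F} x_i$ has annihilator $P_F = (x_i : i \notin F)$ modulo \<open>I\<close>.
  If a regular sequence were longer than $\dim S/P_F = |F|$, then so would be the sequence of its
  $(|F| + 1)$-st powers, and its algebraic dependence modulo $P_F$ would put $x_F$ into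
  the ideal generated by \<open>I\<close> and these powers, whose elements involve no monomial of degree at
  most $|F|$ outside \<open>I\<close>.
\<close>

lemma depth_Quot_mono_ideal_le:
  fixes Q :: "(nat \<Rightarrow>\<^sub>0 nat) \<Rightarrow> bool" and n :: nat
  defines "I \<equiv> mono_ideal n Q :: 'k::field mpoly set"
  assumes up: "\<And>m m'. Q m \<Longrightarrow> Q (m' + m)" and F: "F \<subseteq> {1..n}"
    and face: "\<not> Q (indicator_exponent F)"
    and facet: "\<And>i. i \<in> {1..n} - F \<Longrightarrow> Q (indicator_exponent F + Poly_Mapping.single i 1)"
  shows "depth (poly_ring n Quot I) ((+>\<^bsub>poly_ring n\<^esub>) I ` irrelevant_ideal n) \<le> enat (card F)"
  unfolding depth_def
proof (rule Sup_least)
  let ?h = "(+>\<^bsub>poly_ring n\<^esub>) I"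
  have fin: "finite F" using F finite_subset by blast
  have I: "ideal I (poly_ring n)" unfolding I_def by (rule mono_ideal_ideal) (rule up)
  fix l assume "l \<in> {enat (length xs) | xs. set xs \<subseteq> ?h ` irrelevant_ideal n \<and>
    regular_sequence (poly_ring n Quot I) xs}"
  then obtain xs where l: "l = enat (length xs)" and xs: "set xs \<subseteq> ?h ` irrelevant_ideal n"
    "regular_sequence (poly_ring n Quot I) xs" by blast
  \<comment> \<open>The representatives are chosen inside the irrelevant ideal: having no constant
    term, they gain degree when raised to powers.\<close>
  have "xs \<in> map ?h ` lists (irrelevant_ideal n)"
    using xs(1) unfolding lists_image[symmetric] by auto
  then obtain as where as: "set as \<subseteq> irrelevant_ideal n" "xs = map ?h as" by auto
  have as_deg: "set as \<subseteq> mono_ideal n (\<lambda>m. 1 \<le> total_degree n m)"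
    using as(1) irrelevant_ideal_subset by blast
  then have as_carr: "set as \<subseteq> carrier (poly_ring n)" by (auto simp: mono_ideal_def)
  have "regular_mod n I as"
    using xs(2) regular_sequence_Quot_iff[OF I as_carr] as(2) by simp
  define N where "N = card F"
  define bs where "bs = map (\<lambda>a. a ^ Suc N) as"
  have bs: "set bs \<subseteq> carrier (poly_ring n)"
    unfolding bs_def using as_carr by (auto simp del: power_Suc intro!: poly_ring_closed_power)
  have reg: "regular_mod n I bs"
    unfolding bs_def by (rule regular_mod_power[OF I as_carr \<open>regular_mod n I as\<close>])
  define D where "D i = foldl (adjoin n) I (take i bs)" for i
  define x where "x = Poly_Mapping.single (indicator_exponent F) (1 :: 'k)"
  have take_bs: "set (take i bs) \<subseteq> carrier (poly_ring n)" for i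
    using bs set_take_subset by fast
  have D: "ideal (D i) (poly_ring n)" for i
    unfolding D_def by (rule foldl_adjoin_ideal[OF I take_bs])
  have D_Suc: "D (Suc i) = adjoin n (D i) (bs ! i)" if "i < length bs" for i
    unfolding D_def using that by (simp add: take_Suc_conv_app_nth)
  have x: "x \<in> carrier (poly_ring n)"
    unfolding x_def using F by (intro single_in_poly_ring) (simp add: keys_indicator_exponent[OF fin])
  have "length bs \<le> card F"
  proof (rule ccontr)
    assume "\<not> length bs \<le> card F"
    then have less: "card F < length bs" by simp
    have "1 \<in> colon n (D (length bs)) x"
    proof (rule one_mem_of_chain[OF fin less bs])
      show "ideal (colon n (D i) x) (poly_ring n)" for i by (rule colon_ideal[OF D])
      show "colon n (D i) x \<subseteq> colon n (D (Suc i)) x \<and> bs ! i \<in> colon n (D (Suc i)) x"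
        if i: "i < length bs" for i
      proof
        show "colon n (D i) x \<subseteq> colon n (D (Suc i)) x"
          unfolding D_Suc[OF i] using adjoin_supset[of "D i" n "bs ! i"] by (auto simp: colon_def)
        have b: "bs ! i \<in> carrier (poly_ring n)" using i bs by auto
        have "bs ! i \<in> D (Suc i)" unfolding D_Suc[OF i] by (rule adjoin_self[OF D])
        then have "x * bs ! i \<in> D (Suc i)" by (rule poly_ring_idealD(4)[OF D x])
        then show "bs ! i \<in> colon n (D (Suc i)) x" using b by (simp add: colon_def)
      qed
      show "y \<in> colon n (D i) x"
        if i: "i < length bs" and y: "y \<in> carrier (poly_ring n)" "bs ! i * y \<in> colon n (D i) x" for i y
      proof -
        have "bs ! i * (x * y) \<in> D i" using y(2) by (simp add: colon_def mult.left_commute)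
        then have "x * y \<in> D i"
          using reg i poly_ring_closed(2)[OF x y(1)] unfolding regular_mod_iff_nth D_def by blast
        then show ?thesis using y(1) by (simp add: colon_def)
      qed
      show "outside_ideal n F \<subseteq> colon n (D 0) x"
      proof (rule outside_ideal_subset[OF colon_ideal[OF D]])
        fix i assume i: "i \<in> {1..n} - F"
        have "x * X i = Poly_Mapping.single (indicator_exponent F + Poly_Mapping.single i 1) 1"
          by (simp add: x_def X_def mult_single)
        also have "\<dots> \<in> I"
          unfolding I_def mono_ideal_def
          using facet[OF i] i F by (auto simp: keys_plus_nat keys_indicator_exponent[OF fin] intro!: single_in_poly_ring)
        finally show "X i \<in> colon n (D 0) x"
          using i by (simp add: colon_def D_def X_in_carrier)
      qed
    qed
    then have "x \<in> D (length bs)" by (simp add: colon_def)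
    moreover have "D (length bs) \<subseteq> mono_ideal n (\<lambda>m. Q m \<or> Suc N \<le> total_degree n m)"
      unfolding D_def
    proof (rule foldl_adjoin_least)
      show "ideal (mono_ideal n (\<lambda>m. Q m \<or> Suc N \<le> total_degree n m)) (poly_ring n)"
        by (rule mono_ideal_ideal) (auto simp: up total_degree_add)
      show "I \<subseteq> mono_ideal n (\<lambda>m. Q m \<or> Suc N \<le> total_degree n m)"
        by (auto simp: I_def mono_ideal_def)
      have "b \<in> mono_ideal n (\<lambda>m. Suc N \<le> total_degree n m)" if b: "b \<in> set bs" for b
      proof -
        obtain a where "a \<in> set as" "b = a ^ Suc N" using b unfolding bs_def set_map by blast
        then show ?thesis using mono_ideal_power as_deg by blast
      qed
      then show "set (take (length bs) bs) \<subseteq> mono_ideal n (\<lambda>m. Q m \<or> Suc N \<le> total_degree n m)"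
        by (auto simp: mono_ideal_def)
    qed
    ultimately have "x \<in> mono_ideal n (\<lambda>m. Q m \<or> Suc N \<le> total_degree n m)" by blast
    then show False
      using face total_degree_indicator_exponent[OF F] by (simp add: mono_ideal_def x_def N_def)
  qed
  then show "l \<le> enat (card F)" by (simp add: l as(2) bs_def)
qed

section \<open>Path ideals\<close>

definition has_path3 :: "nat set set \<Rightarrow> nat set \<Rightarrow> bool" where
  "has_path3 E U \<longleftrightarrow> (\<exists>a\<in>U. \<exists>b\<in>U. \<exists>c\<in>U. a \<noteq> b \<and> b \<noteq> c \<and> a \<noteq> c \<and> {a, b} \<in> E \<and> {b, c} \<in> E)"

lemma has_path3_mono: "has_path3 E U \<Longrightarrow> U \<subseteq> V \<Longrightarrow> has_path3 E V"
  unfolding has_path3_def by blast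

lemma mono_ideal_has_path3_ideal:
  "ideal (mono_ideal n (\<lambda>m. has_path3 E (Poly_Mapping.keys m)) :: 'k::comm_ring_1 mpoly set) (poly_ring n)"
  by (rule mono_ideal_ideal) (erule has_path3_mono, simp add: keys_plus_nat)

text \<open>Membership depends on supports alone. If the support of a monomial contains a path, its
  three vertices can be divided out in turn; being distinct, the later ones stay in the support
  after each division, and a multiple of a generator appears.\<close>

lemma path3_ideal_eq_mono_ideal:
  "path3_ideal n E = (mono_ideal n (\<lambda>m. has_path3 E (Poly_Mapping.keys m)) :: 'k::comm_ring_1 mpoly set)"
proof
  interpret S: cring "poly_ring n :: 'k mpoly ring" by (rule poly_ring_cring)
  let ?M = "mono_ideal n (\<lambda>m. has_path3 E (Poly_Mapping.keys m)) :: 'k mpoly set"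
  let ?G = "{X a * X b * X c | a b c. a \<in> {1..n} \<and> b \<in> {1..n} \<and> c \<in> {1..n} \<and>
     a \<noteq> b \<and> b \<noteq> c \<and> a \<noteq> c \<and> {a, b} \<in> E \<and> {b, c} \<in> E} :: 'k mpoly set"
  show "path3_ideal n E \<subseteq> ?M"
    unfolding path3_ideal_def
  proof (rule S.genideal_minimal[OF mono_ideal_has_path3_ideal], rule subsetI)
    fix p assume "p \<in> ?G"
    then obtain a b c where p: "p = X a * X b * X c" and abc: "a \<in> {1..n}" "b \<in> {1..n}" "c \<in> {1..n}"
      "a \<noteq> b" "b \<noteq> c" "a \<noteq> c" "{a, b} \<in> E" "{b, c} \<in> E" by blast
    have "p \<in> carrier (poly_ring n)"
      unfolding p by (intro poly_ring_closed X_in_carrier abc)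
    moreover have "p = Poly_Mapping.single
        (Poly_Mapping.single a 1 + Poly_Mapping.single b 1 + Poly_Mapping.single c 1) 1"
      by (simp add: p X_def mult_single)
    moreover have "has_path3 E {a, b, c}" using abc unfolding has_path3_def by blast
    ultimately show "p \<in> ?M" by (simp add: mono_ideal_def keys_plus_nat insert_commute)
  qed
  have gen: "?G \<subseteq> carrier (poly_ring n)"
    by (auto intro!: poly_ring_closed X_in_carrier)
  have J: "ideal (path3_ideal n E) (poly_ring n :: 'k mpoly ring)"
    unfolding path3_ideal_def by (rule S.genideal_ideal[OF gen])
  show "?M \<subseteq> path3_ideal n E"
  proof (rule mono_ideal_subsetI[OF J])
    fix m :: "nat \<Rightarrow>\<^sub>0 nat" and k :: 'k
    assume m: "Poly_Mapping.keys m \<subseteq> {1..n}" "has_path3 E (Poly_Mapping.keys m)"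
    then obtain a b c where abc: "a \<in> Poly_Mapping.keys m" "b \<in> Poly_Mapping.keys m" "c \<in> Poly_Mapping.keys m"
      "a \<noteq> b" "b \<noteq> c" "a \<noteq> c" "{a, b} \<in> E" "{b, c} \<in> E" unfolding has_path3_def by blast
    let ?ma = "m - Poly_Mapping.single a 1"
    let ?mb = "?ma - Poly_Mapping.single b 1"
    let ?mc = "?mb - Poly_Mapping.single c 1"
    have "b \<in> Poly_Mapping.keys ?ma" "c \<in> Poly_Mapping.keys ?mb"
      using abc by (auto simp: in_keys_iff lookup_minus lookup_single)
    then have "Poly_Mapping.single m k = X a * (X b * (X c * Poly_Mapping.single ?mc k))"
      using single_eq_X_mult[OF abc(1), of k] single_eq_X_mult[of b ?ma k] single_eq_X_mult[of c ?mb k]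
      by simp
    then have eq: "Poly_Mapping.single m k = X a * X b * X c * Poly_Mapping.single ?mc k"
      by (simp add: mult.assoc)
    have "(X a * X b * X c :: 'k mpoly) \<in> ?G"
      using abc m(1) by (intro CollectI exI[of _ a] exI[of _ b] exI[of _ c]) auto
    then have "(X a * X b * X c :: 'k mpoly) \<in> path3_ideal n E"
      unfolding path3_ideal_def by (rule subsetD[OF S.genideal_self[OF gen]])
    moreover have "Poly_Mapping.keys ?mc \<subseteq> {1..n}"
      using m(1) keys_diff_subset by (meson order_trans)
    ultimately show "Poly_Mapping.single m k \<in> path3_ideal n E"
      unfolding eq using poly_ring_idealD(5)[OF J single_in_poly_ring] by blast
  qed
qed

lemma krull_dim_path3_ideal_ge:
  assumes "F \<subseteq> {1..n}" "\<not> has_path3 E F"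
  shows "enat (card F) \<le> krull_dim (poly_ring n Quot (path3_ideal n E :: 'k::field mpoly set))"
  unfolding path3_ideal_eq_mono_ideal
proof (rule krull_dim_Quot_ge[OF mono_ideal_has_path3_ideal assms(1)])
  show "mono_ideal n (\<lambda>m. has_path3 E (Poly_Mapping.keys m)) \<subseteq> outside_ideal n F"
    using assms(2) has_path3_mono unfolding mono_ideal_def by blast
qed

lemma depth_path3_ideal_le:
  assumes "F \<subseteq> {1..n}" "\<not> has_path3 E F" "\<And>i. i \<in> {1..n} - F \<Longrightarrow> has_path3 E (insert i F)"
  shows "depth (poly_ring n Quot (path3_ideal n E :: 'k::field mpoly set))
    ((+>\<^bsub>poly_ring n\<^esub>) (path3_ideal n E) ` irrelevant_ideal n) \<le> enat (card F)"
proof -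
  have fin: "finite F" using assms(1) finite_subset by blast
  show ?thesis
    unfolding path3_ideal_eq_mono_ideal
  proof (rule depth_Quot_mono_ideal_le[OF _ assms(1)])
    show "has_path3 E (Poly_Mapping.keys (m' + m))" if "has_path3 E (Poly_Mapping.keys m)" for m m' :: "nat \<Rightarrow>\<^sub>0 nat"
      using that by (rule has_path3_mono) (simp add: keys_plus_nat)
  qed (use assms(2,3) in \<open>simp_all add: keys_plus_nat keys_indicator_exponent[OF fin]\<close>)
qed

section \<open>Squares of paths, and the failure from five vertices on\<close>

lemma path_square_edge_iff:
  "a \<noteq> b \<Longrightarrow> {a, b} \<in> path_square n \<longleftrightarrow> a \<in> {1..n} \<and> b \<in> {1..n} \<and> a \<le> b + 2 \<and> b \<le> a + 2"
proof
  assume ab: "a \<noteq> b"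
  show "a \<in> {1..n} \<and> b \<in> {1..n} \<and> a \<le> b + 2 \<and> b \<le> a + 2" if "{a, b} \<in> path_square n"
    using that unfolding path_square_def by (auto simp: doubleton_eq_iff)
  show "{a, b} \<in> path_square n" if "a \<in> {1..n} \<and> b \<in> {1..n} \<and> a \<le> b + 2 \<and> b \<le> a + 2"
  proof (cases "a < b")
    case True
    with that show ?thesis unfolding path_square_def by (intro CollectI exI[of _ a] exI[of _ b]) auto
  next
    case False
    with that ab show ?thesis unfolding path_square_def
      by (intro CollectI exI[of _ b] exI[of _ a]) (auto simp: insert_commute)
  qed
qed

text \<open>
  A facet \<open>F\<close> through the edge \<open>{3, 5}\<close> contains no other vertex up to 7, so that replacing
  \<open>{3, 5}\<close> by \<open>{1, 2, 5}\<close> gives a larger face: the complex is not pure.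
\<close>

lemma not_cohen_macaulay_path_square:
  assumes "5 \<le> n"
  shows "\<not> cohen_macaulay_quotient n (path3_ideal n (path_square n) :: 'k::field mpoly set)"
proof -
  let ?E = "path_square n"
  let ?I = "path3_ideal n ?E :: 'k mpoly set"
  have pathI: "has_path3 ?E U"
    if "a \<in> U" "b \<in> U" "c \<in> U" "a \<noteq> b" "b \<noteq> c" "a \<noteq> c" "U \<subseteq> {1..n}"
      "a \<le> b + 2" "b \<le> a + 2" "b \<le> c + 2" "c \<le> b + 2" for U a b c
  proof -
    have "{a, b} \<in> ?E" "{b, c} \<in> ?E" using that by (auto simp: path_square_edge_iff)
    then show ?thesis unfolding has_path3_def using that by blast
  qed
  let ?A = "{U. U \<subseteq> {1..n} \<and> \<not> has_path3 ?E U}"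
  have "\<not> has_path3 ?E {3, 5}" by (auto simp: has_path3_def)
  then have "{3, 5} \<in> ?A" using assms by auto
  moreover have "finite ?A" by (rule finite_subset[of _ "Pow {1..n}"]) auto
  \<comment> \<open>Finiteness alone provides the facet; its vertices beyond 7 never have to be
    determined, which makes the argument uniform in \<open>n\<close>.\<close>
  ultimately have "\<exists>F\<in>?A. {3, 5} \<subseteq> F \<and> (\<forall>U\<in>?A. F \<subseteq> U \<longrightarrow> F = U)"
    by (intro finite_has_maximal2)
  then obtain F where FA: "F \<in> ?A" and sup: "{3, 5} \<subseteq> F"
    and max: "\<forall>U\<in>?A. F \<subseteq> U \<longrightarrow> F = U" by (elim bexE conjE)
  from FA have F: "F \<subseteq> {1..n}" "\<not> has_path3 ?E F" by simp_all
  have facet: "has_path3 ?E (insert i F)" if "i \<in> {1..n} - F" for i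
  proof (rule ccontr)
    assume "\<not> has_path3 ?E (insert i F)"
    then have "insert i F \<in> ?A" using that F(1) by simp
    then have "F = insert i F" using max subset_insertI[of F i] by blast
    with that show False by blast
  qed
  \<comment> \<open>The vertices 1 and 2 are adjacent to 3, the vertices 6 and 7 to 5, and 4 to
    both, so each of them would complete the edge {3, 5} to a path inside \<open>F\<close>.\<close>
  have far: "8 \<le> i" if i: "i \<in> F" "i \<noteq> 3" "i \<noteq> 5" for i
  proof (rule ccontr)
    assume "\<not> 8 \<le> i"
    moreover have "1 \<le> i" using i F(1) by auto
    ultimately consider "i \<in> {1, 2}" | "i = 4" | "i \<in> {6, 7}" using i by fastforce
    then show False
    proof cases
      case 1
      then show False using pathI[of i F 3 5] F i sup by auto
    next
      case 2
      then show False using pathI[of 3 F i 5] F i sup by auto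
    next
      case 3
      then show False using pathI[of 3 F 5 i] F i sup by auto
    qed
  qed
  let ?G = "{1, 2, 5} \<union> (F - {3, 5})"
  have G: "?G \<subseteq> {1..n}" using F(1) assms by auto
  have "\<not> has_path3 ?E ?G"
  proof
    assume "has_path3 ?E ?G"
    then obtain a b c where abc: "a \<in> ?G" "b \<in> ?G" "c \<in> ?G" "a \<noteq> b" "b \<noteq> c" "a \<noteq> c"
      "{a, b} \<in> ?E" "{b, c} \<in> ?E" unfolding has_path3_def by blast
    have near: "a \<le> b + 2" "b \<le> a + 2" "b \<le> c + 2" "c \<le> b + 2"
      using abc(4-8) by (simp_all add: path_square_edge_iff)
    have range: "x \<in> {1, 2, 5} \<or> 8 \<le> x \<and> x \<in> F" if "x \<in> ?G" for x using that far by auto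
    \<comment> \<open>Among 1, 2, 5 the only edge is {1, 2}, and none of the three is adjacent to a
      vertex from 8 on. So none can be the middle of a path, and a path with its middle beyond 7
      stays within \<open>F\<close>.\<close>
    have "8 \<le> b \<and> b \<in> F" using range[OF abc(1)] range[OF abc(2)] range[OF abc(3)] near abc(4-6) by auto
    then have "a \<in> F" "b \<in> F" "c \<in> F"
      using range[OF abc(1)] range[OF abc(3)] near by auto
    then show False using F(2) abc(4-8) unfolding has_path3_def by blast
  qed
  then have "enat (card ?G) \<le> krull_dim (poly_ring n Quot ?I)"
    by (rule krull_dim_path3_ideal_ge[OF G])
  moreover have "depth (poly_ring n Quot ?I) ((+>\<^bsub>poly_ring n\<^esub>) ?I ` irrelevant_ideal n) \<le> enat (card F)"
    by (rule depth_path3_ideal_le[OF F facet])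
  moreover have "card F < card ?G"
  proof -
    have fin: "finite F" using F(1) finite_subset by blast
    have "card F = card (F - {3, 5}) + 2"
      using card_Diff_subset[of "{3, 5}" F] sup card_mono[OF fin sup] by simp
    moreover have "card ?G = card {1, 2, 5 :: nat} + card (F - {3, 5})"
      using fin far by (intro card_Un_disjoint) force+
    ultimately show ?thesis by simp
  qed
  ultimately have "depth (poly_ring n Quot ?I) ((+>\<^bsub>poly_ring n\<^esub>) ?I ` irrelevant_ideal n)
      < krull_dim (poly_ring n Quot ?I)"
    by (meson enat_ord_simps(2) less_le_trans le_less_trans)
  then show ?thesis by (simp add: cohen_macaulay_quotient_def Let_def)
qed

section \<open>Evaluation at univariate polynomials\<close>

definition eval_monomial :: "(nat \<Rightarrow> 'b::comm_ring_1) \<Rightarrow> (nat \<Rightarrow>\<^sub>0 nat) \<Rightarrow> 'b" where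
  "eval_monomial y m = (\<Prod>i\<in>Poly_Mapping.keys m. y i ^ Poly_Mapping.lookup m i)"

text \<open>Values are univariate polynomials and not scalars: over a finite field the points of a
  line do not determine a polynomial on it, whereas a generic point does.\<close>

definition eval_mpoly :: "(nat \<Rightarrow> 'k::field poly) \<Rightarrow> 'k mpoly \<Rightarrow> 'k poly" where
  "eval_mpoly y p = (\<Sum>m\<in>Poly_Mapping.keys p. smult (Poly_Mapping.lookup p m) (eval_monomial y m))"

lemma eval_monomial_superset:
  assumes "finite A" "Poly_Mapping.keys m \<subseteq> A"
  shows "eval_monomial y m = (\<Prod>i\<in>A. y i ^ Poly_Mapping.lookup m i)"
  unfolding eval_monomial_def using assms by (intro prod.mono_neutral_left) (auto simp: in_keys_iff)

lemma eval_monomial_add: "eval_monomial y (m + m') = eval_monomial y m * eval_monomial y m'"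
proof -
  let ?A = "Poly_Mapping.keys m \<union> Poly_Mapping.keys m'"
  show ?thesis
    using eval_monomial_superset[of ?A m y] eval_monomial_superset[of ?A m' y]
      eval_monomial_superset[of ?A "m + m'" y]
    by (simp add: keys_plus_nat lookup_add power_add prod.distrib)
qed

lemma eval_monomial_single [simp]: "eval_monomial y (Poly_Mapping.single i k) = y i ^ k"
  by (simp add: eval_monomial_def)

lemma eval_mpoly_single [simp]: "eval_mpoly y (Poly_Mapping.single m c) = smult c (eval_monomial y m)"
  by (simp add: eval_mpoly_def)

lemma eval_mpoly_X [simp]: "eval_mpoly y (X i) = y i"
  by (simp add: X_def)

lemma eval_mpoly_zero [simp]: "eval_mpoly y 0 = 0"
  by (simp add: eval_mpoly_def)

lemma eval_mpoly_add: "eval_mpoly y (p + q) = eval_mpoly y p + eval_mpoly y q"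
  unfolding eval_mpoly_def by (rule setsum_keys_plus_distrib) (simp_all add: smult_add_left)

lemma eval_mpoly_sum: "eval_mpoly y (sum f A) = (\<Sum>a\<in>A. eval_mpoly y (f a))"
  by (induction A rule: infinite_finite_induct) (simp_all add: eval_mpoly_add)

lemma eval_mpoly_diff: "eval_mpoly y (p - q) = eval_mpoly y p - eval_mpoly y q"
  using eval_mpoly_add[of y "p - q" q] by simp

lemma eval_mpoly_mult: "eval_mpoly y (p * q) = eval_mpoly y p * eval_mpoly y q"
proof -
  have "p * q = (\<Sum>m\<in>Poly_Mapping.keys p. Poly_Mapping.single m (Poly_Mapping.lookup p m)) *
      (\<Sum>m\<in>Poly_Mapping.keys q. Poly_Mapping.single m (Poly_Mapping.lookup q m))"
    by (simp add: poly_mapping_expand)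
  then have "eval_mpoly y (p * q) = (\<Sum>m\<in>Poly_Mapping.keys p. \<Sum>m'\<in>Poly_Mapping.keys q.
      smult (Poly_Mapping.lookup p m) (eval_monomial y m) *
      smult (Poly_Mapping.lookup q m') (eval_monomial y m'))"
    by (simp add: sum_product mult_single eval_mpoly_sum eval_monomial_add mult.commute)
  then show ?thesis by (simp add: eval_mpoly_def sum_product)
qed

section \<open>The ideal of the complete graph\<close>

text \<open>
  The Stanley-Reisner ideal of the complete graph on $\{1, \ldots, n\}$, viewed as a
  one-dimensional simplicial complex.
\<close>

definition cubic_ideal :: "nat \<Rightarrow> 'k::field mpoly set" where
  "cubic_ideal n = mono_ideal n (\<lambda>m. 3 \<le> card (Poly_Mapping.keys m))"

definition sum_vars :: "nat \<Rightarrow> 'k::field mpoly" where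
  "sum_vars n = (\<Sum>i\<in>{1..n}. X i)"

definition sum_edges :: "nat \<Rightarrow> 'k::field mpoly" where
  "sum_edges n = (\<Sum>(i, j)\<in>{(i, j). i \<in> {1..n} \<and> j \<in> {1..n} \<and> i < j}. X i * X j)"

text \<open>The generic point of the line spanned by e_i - e_j, with the indeterminate
  \<open>monom 1 1\<close> as parameter t.\<close>

definition line :: "nat \<Rightarrow> nat \<Rightarrow> nat \<Rightarrow> 'k::field poly" where
  "line i j k = (if k = i then monom 1 1 else if k = j then - monom 1 1 else 0)"

lemma cubic_ideal_ideal: "ideal (cubic_ideal n) (poly_ring n)"
  unfolding cubic_ideal_def
proof (rule mono_ideal_ideal)
  fix m m' :: "nat \<Rightarrow>\<^sub>0 nat" assume "3 \<le> card (Poly_Mapping.keys m)"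
  also have "\<dots> \<le> card (Poly_Mapping.keys (m' + m))"
    by (rule card_mono) (auto simp: keys_plus_nat)
  finally show "3 \<le> card (Poly_Mapping.keys (m' + m))" .
qed

lemma sum_vars_closed: "sum_vars n \<in> carrier (poly_ring n)"
  unfolding sum_vars_def by (intro poly_ring_sum_closed X_in_carrier)

lemma lookup_X_single: "Poly_Mapping.lookup (X k) (Poly_Mapping.single i 1) = (1 when k = i)"
proof -
  have "Poly_Mapping.single k (1 :: nat) = Poly_Mapping.single i 1 \<longleftrightarrow> k = i"
    by (metis keys_single singleton_inject zero_neq_one)
  then show ?thesis by (simp add: X_def lookup_single when_def)
qed

text \<open>A term of \<open>y\<close> with at most two variables is supported in some two-element
  \<open>T\<close>, as \<open>n \<ge> 2\<close> leaves room to enlarge its support. Restricted to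
  \<open>T\<close>, every element of the cubic ideal vanishes while the sum of the variables does
  not, so the restriction of \<open>y\<close> would have to vanish in a domain.\<close>

lemma sum_vars_cancel:
  fixes y :: "'k::field mpoly"
  assumes n: "2 \<le> n" and y: "y \<in> carrier (poly_ring n)" and mem: "sum_vars n * y \<in> cubic_ideal n"
  shows "y \<in> cubic_ideal n"
proof -
  have "3 \<le> card (Poly_Mapping.keys m)" if m: "m \<in> Poly_Mapping.keys y" for m
  proof (rule ccontr)
    assume "\<not> 3 \<le> card (Poly_Mapping.keys m)"
    moreover have "Poly_Mapping.keys m \<subseteq> {1..n}" using y m by (simp add: poly_ring_def)
    ultimately obtain T where T: "Poly_Mapping.keys m \<subseteq> T" "T \<subseteq> {1..n}" "card T = 2"
      using exists_subset_between[of "Poly_Mapping.keys m" 2 "{1..n}"] n by auto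
    have fin: "finite T" using T(2) finite_subset by blast
    obtain i where i: "i \<in> T" using T(3) by fastforce
    have "restrict_vars T (sum_vars n * y) = 0"
      unfolding restrict_vars_eq_0_iff
    proof (rule ballI, rule notI)
      fix m' assume m': "m' \<in> Poly_Mapping.keys (sum_vars n * y)" "Poly_Mapping.keys m' \<subseteq> T"
      then have "3 \<le> card (Poly_Mapping.keys m')" using mem by (simp add: cubic_ideal_def mono_ideal_def)
      also have "\<dots> \<le> card T" by (rule card_mono[OF fin m'(2)])
      finally show False using T(3) by simp
    qed
    moreover have "restrict_vars T y \<noteq> 0" using m T(1) by (auto simp: restrict_vars_eq_0_iff)
    ultimately have "restrict_vars T (sum_vars n :: 'k mpoly) = 0" by (simp add: restrict_vars_mult)
    then have "Poly_Mapping.lookup (restrict_vars T (sum_vars n :: 'k mpoly)) (Poly_Mapping.single i 1) = 0"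
      by simp
    then have "Poly_Mapping.lookup (sum_vars n :: 'k mpoly) (Poly_Mapping.single i 1) = 0"
      using i unfolding lookup_restrict_vars by simp
    then have "(\<Sum>k\<in>{1..n}. (1 :: 'k) when k = i) = 0"
      unfolding sum_vars_def lookup_sum lookup_X_single .
    then show False using i T(2) by (auto simp: when_def)
  qed
  then show ?thesis using y by (simp add: cubic_ideal_def mono_ideal_def)
qed

text \<open>
  \<open>S/(cubic_ideal n + sum_vars n)\<close> is the coordinate ring of the lines $x_i + x_j = 0$,
  $x_k = 0$ for $k \neq i, j$. The standard monomials below span it, and evaluation
  on the lines recovers all coefficients of a combination of them.
\<close>

abbreviation lines_ideal :: "nat \<Rightarrow> 'k::field mpoly set" where
  "lines_ideal n \<equiv> adjoin n (cubic_ideal n) (sum_vars n)"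

lemma lines_ideal_ideal: "ideal (lines_ideal n) (poly_ring n)"
  by (rule adjoin_ideal[OF cubic_ideal_ideal sum_vars_closed])

text \<open>What is left after x_n is eliminated by the sum of the variables and x_j^2 by the
  relation x_i x_j (x_i + x_j) = 0. In each degree at least 2 there are (n - 1) + (n - 1)(n - 2)/2 =
  n (n - 1)/2 of them, exactly as many as lines. The exponent 0 in the first family admits the
  monomial 1.\<close>

definition standard_monomials :: "nat \<Rightarrow> (nat \<Rightarrow>\<^sub>0 nat) set" where
  "standard_monomials n = {Poly_Mapping.single i k | i k. i \<in> {1..<n}} \<union>
     {Poly_Mapping.single i k + Poly_Mapping.single j 1 | i j k. 1 \<le> i \<and> i < j \<and> j < n \<and> 1 \<le> k}"

definition reducible :: "nat \<Rightarrow> 'k::field mpoly \<Rightarrow> bool" where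
  "reducible n p \<longleftrightarrow> (\<exists>q. Poly_Mapping.keys q \<subseteq> standard_monomials n \<and> p - q \<in> lines_ideal n)"

lemma reducible_add:
  assumes "reducible n p" "reducible n q"
  shows "reducible n (p + q)"
proof -
  from assms obtain r s where rs: "Poly_Mapping.keys r \<subseteq> standard_monomials n" "p - r \<in> lines_ideal n"
    "Poly_Mapping.keys s \<subseteq> standard_monomials n" "q - s \<in> lines_ideal n"
    unfolding reducible_def by blast
  have "(p - r) + (q - s) \<in> lines_ideal n" by (rule poly_ring_idealD(3)[OF lines_ideal_ideal rs(2,4)])
  moreover have "Poly_Mapping.keys (r + s) \<subseteq> standard_monomials n"
    using Poly_Mapping.keys_add[of r s] rs(1,3) by blast
  ultimately show ?thesis unfolding reducible_def by (intro exI[of _ "r + s"]) (simp add: algebra_simps)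
qed

lemma reducible_uminus: "reducible n p \<Longrightarrow> reducible n (- p)"
proof -
  assume "reducible n p"
  then obtain r where r: "Poly_Mapping.keys r \<subseteq> standard_monomials n" "p - r \<in> lines_ideal n"
    unfolding reducible_def by blast
  have "- (p - r) \<in> lines_ideal n" by (rule poly_ring_idealD(6)[OF lines_ideal_ideal r(2)])
  moreover have "Poly_Mapping.keys (- r) = Poly_Mapping.keys r" by (auto simp: in_keys_iff)
  ultimately show ?thesis unfolding reducible_def using r(1) by (intro exI[of _ "- r"]) simp
qed

lemma reducible_ideal: "p \<in> lines_ideal n \<Longrightarrow> reducible n p"
  unfolding reducible_def by (intro exI[of _ 0]) simp

lemma reducible_sum: "(\<And>i. i \<in> A \<Longrightarrow> reducible n (f i)) \<Longrightarrow> reducible n (sum f A)"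
proof (induction A rule: infinite_finite_induct)
  case (insert i A)
  then show ?case by (simp add: reducible_add)
qed (use reducible_ideal poly_ring_idealD(2)[OF lines_ideal_ideal] in auto)

lemma reducible_standard: "m \<in> standard_monomials n \<Longrightarrow> reducible n (Poly_Mapping.single m c)"
  unfolding reducible_def using poly_ring_idealD(2)[OF lines_ideal_ideal]
  by (intro exI[of _ "Poly_Mapping.single m c"]) auto

lemma single_cubic:
  assumes "Poly_Mapping.keys m \<subseteq> {1..n}" "3 \<le> card (Poly_Mapping.keys m)"
  shows "Poly_Mapping.single m c \<in> cubic_ideal n"
  using assms by (simp add: cubic_ideal_def mono_ideal_def poly_ring_def)

text \<open>Multiply x_i^k x_j^(l+1) by the sum of the variables: every third variable gives an
  element of the cubic ideal, so x_i^k x_j^(l+2) is congruent to - x_i^(k+1) x_j^(l+1). The exponent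
  of x_j thus descends to 1 while that of x_i grows, hence the general \<open>k\<close> in the
  induction.\<close>

lemma reducible_pair:
  fixes c :: "'k::field"
  assumes ij: "1 \<le> i" "i < j" "j < n"
  shows "1 \<le> k \<Longrightarrow> reducible n (Poly_Mapping.single (Poly_Mapping.single i k + Poly_Mapping.single j (Suc l)) c)"
proof (induction l arbitrary: k)
  case 0
  then have "Poly_Mapping.single i k + Poly_Mapping.single j 1 \<in> standard_monomials n"
    unfolding standard_monomials_def using ij by blast
  then show ?case using reducible_standard by simp
next
  case (Suc l)
  let ?m = "Poly_Mapping.single i k + Poly_Mapping.single j (Suc l)"
  let ?p = "Poly_Mapping.single ?m c"
  have keys: "Poly_Mapping.keys ?m = {i, j}" using Suc.prems by (auto simp: keys_plus_nat)
  have i: "i \<in> {1..n}" and j: "j \<in> {1..n}" using ij by auto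
  have split: "sum_vars n = (X i + X j) + (\<Sum>a\<in>{1..n} - {i, j}. X a :: 'k mpoly)"
    unfolding sum_vars_def using ij i j
    by (subst sum.subset_diff[of "{i, j}"]) (auto simp: add.commute)
  have "?p \<in> carrier (poly_ring n)" using keys i j by (intro single_in_poly_ring) auto
  then have "sum_vars n * ?p \<in> lines_ideal n"
    by (intro poly_ring_idealD(5)[OF lines_ideal_ideal] adjoin_self cubic_ideal_ideal)
  moreover have "X a * ?p \<in> lines_ideal n" if a: "a \<in> {1..n} - {i, j}" for a
  proof -
    have "3 \<le> card {a, i, j}" using a ij by auto
    moreover have "Poly_Mapping.keys (Poly_Mapping.single a 1 + ?m) = {a, i, j}"
      unfolding keys_plus_nat[of "Poly_Mapping.single a 1"] keys by auto
    moreover have "{a, i, j} \<subseteq> {1..n}" using a i j by blast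
    ultimately have "Poly_Mapping.single (Poly_Mapping.single a 1 + ?m) c \<in> cubic_ideal n"
      using single_cubic by metis
    moreover have "X a * ?p = Poly_Mapping.single (Poly_Mapping.single a 1 + ?m) c"
      by (simp add: X_def mult_single)
    ultimately show ?thesis using adjoin_supset by auto
  qed
  then have "(\<Sum>a\<in>{1..n} - {i, j}. X a) * ?p \<in> lines_ideal n"
    unfolding sum_distrib_right by (intro poly_ring_ideal_sum[OF lines_ideal_ideal])
  ultimately have "sum_vars n * ?p - (\<Sum>a\<in>{1..n} - {i, j}. X a) * ?p \<in> lines_ideal n"
    by (rule poly_ring_idealD(7)[OF lines_ideal_ideal])
  then have "reducible n (X i * ?p + X j * ?p)"
    by (intro reducible_ideal) (simp add: split algebra_simps)
  moreover have "X i * ?p = Poly_Mapping.single (Poly_Mapping.single i (Suc k) + Poly_Mapping.single j (Suc l)) c"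
    by (simp add: X_def mult_single add.assoc[symmetric] single_add[symmetric])
  then have "reducible n (X i * ?p)" using Suc.IH[of "Suc k"] by simp
  ultimately have "reducible n ((X i * ?p + X j * ?p) + - (X i * ?p))"
    using reducible_add reducible_uminus by blast
  then have "reducible n (X j * ?p)" unfolding add_uminus_conv_diff add_diff_cancel_left' .
  moreover have "X j * ?p = Poly_Mapping.single (Poly_Mapping.single i k + Poly_Mapping.single j (Suc (Suc l))) c"
    by (simp add: X_def mult_single add.left_commute single_add[symmetric])
  ultimately show ?case by simp
qed

lemma reducible_without_last:
  assumes n: "2 \<le> n" and m: "Poly_Mapping.keys m \<subseteq> {1..<n}"
  shows "reducible n (Poly_Mapping.single m (c :: 'k::field))"
proof -
  let ?K = "Poly_Mapping.keys m"
  consider "?K = {}" | i where "?K = {i}" | i j where "?K = {i, j}" "i < j" | "3 \<le> card ?K"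
  proof -
    have "card ?K = 0 \<or> card ?K = 1 \<or> card ?K = 2 \<or> 3 \<le> card ?K" by linarith
    then show thesis
    proof (elim disjE)
      assume "card ?K = 2"
      then obtain i j where "?K = {i, j}" "i \<noteq> j" by (auto simp: card_2_iff)
      then show thesis using that(3)[of i j] that(3)[of j i] by (metis insert_commute linorder_neqE_nat)
    qed (use that in \<open>auto simp: card_1_singleton_iff\<close>)
  qed
  then show ?thesis
  proof cases
    case 1
    \<comment> \<open>The constant monomial is read as x_1^0; index 1 is allowed because it is less
      than \<open>n\<close>.\<close>
    then have "m = Poly_Mapping.single 1 0" by simp
    then have "m \<in> standard_monomials n" using n unfolding standard_monomials_def by fastforce
    then show ?thesis by (rule reducible_standard)
  next
    case (2 i)
    then have "m = Poly_Mapping.single i (Poly_Mapping.lookup m i)"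
      using poly_mapping_expand[of m] by simp
    then have "m \<in> standard_monomials n" using 2 m unfolding standard_monomials_def by blast
    then show ?thesis by (rule reducible_standard)
  next
    case (3 i j)
    have pos: "1 \<le> Poly_Mapping.lookup m i" "Poly_Mapping.lookup m j \<noteq> 0"
      using 3(1) by (auto simp: Suc_le_eq simp flip: neq0_conv in_keys_iff)
    then obtain l where l: "Poly_Mapping.lookup m j = Suc l" using not0_implies_Suc by blast
    have "m = Poly_Mapping.single i (Poly_Mapping.lookup m i) + Poly_Mapping.single j (Suc l)"
      using poly_mapping_expand[of m] 3 l by simp
    moreover have "1 \<le> i" "j < n" using 3 m by auto
    ultimately show ?thesis using reducible_pair[of i j n _ l c] 3(2) pos(1) by metis
  next
    case 4
    then have "Poly_Mapping.single m c \<in> cubic_ideal n" using m by (intro single_cubic) auto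
    then show ?thesis using adjoin_supset reducible_ideal by blast
  qed
qed

text \<open>Induction on the exponent of x_n, one factor of which is replaced by -(x_1 + ... +
  x_(n-1)); each resulting monomial has one factor x_n less.\<close>

lemma reducible_single:
  assumes n: "2 \<le> n"
  shows "Poly_Mapping.keys m \<subseteq> {1..n} \<Longrightarrow> reducible n (Poly_Mapping.single m (c :: 'k::field))"
proof (induction "Poly_Mapping.lookup m n" arbitrary: m)
  case 0
  then have "n \<notin> Poly_Mapping.keys m" by (simp add: in_keys_iff)
  moreover have "{1..n} - {n} \<subseteq> {1..<n}" by auto
  ultimately have "Poly_Mapping.keys m \<subseteq> {1..<n}" using 0(2) by blast
  then show ?case by (rule reducible_without_last[OF n])
next
  case (Suc k)
  define m' where "m' = m - Poly_Mapping.single n 1"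
  have nk: "n \<in> Poly_Mapping.keys m" using Suc.hyps(2) by (simp add: in_keys_iff)
  have keys': "Poly_Mapping.keys m' \<subseteq> {1..n}"
    using Suc.prems keys_diff_subset unfolding m'_def by blast
  have look': "Poly_Mapping.lookup m' n = k"
    using Suc.hyps(2) by (simp add: m'_def lookup_minus)
  let ?p = "Poly_Mapping.single m' c"
  have eq: "Poly_Mapping.single m c = X n * ?p"
    unfolding m'_def by (rule single_eq_X_mult[OF nk])
  have split: "sum_vars n = X n + (\<Sum>a\<in>{1..<n}. X a :: 'k mpoly)"
  proof -
    have "{1..n} = insert n {1..<n}" using n by auto
    then show ?thesis unfolding sum_vars_def by simp
  qed
  have "?p \<in> carrier (poly_ring n)" by (rule single_in_poly_ring[OF keys'])
  then have "sum_vars n * ?p \<in> lines_ideal n"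
    by (intro poly_ring_idealD(5)[OF lines_ideal_ideal] adjoin_self cubic_ideal_ideal)
  then have "reducible n (sum_vars n * ?p)" by (rule reducible_ideal)
  moreover have "reducible n (\<Sum>a\<in>{1..<n}. X a * ?p)"
  proof (rule reducible_sum)
    fix a assume a: "a \<in> {1..<n}"
    have "X a * ?p = Poly_Mapping.single (Poly_Mapping.single a 1 + m') c"
      by (simp add: X_def mult_single)
    moreover have "Poly_Mapping.lookup (Poly_Mapping.single a 1 + m') n = k"
      using a look' by (simp add: lookup_add lookup_single)
    moreover have "Poly_Mapping.keys (Poly_Mapping.single a 1 + m') \<subseteq> {1..n}"
      using a keys' by (auto simp: keys_plus_nat)
    ultimately show "reducible n (X a * ?p)" using Suc.hyps(1) by metis
  qed
  ultimately have "reducible n (sum_vars n * ?p + - (\<Sum>a\<in>{1..<n}. X a * ?p))"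
    by (intro reducible_add reducible_uminus)
  then show ?case by (simp only: eq split distrib_right sum_distrib_right add_uminus_conv_diff add_diff_cancel_right')
qed

lemma reducible_all:
  assumes "2 \<le> n" "p \<in> carrier (poly_ring n)"
  shows "reducible n p"
proof -
  have "reducible n (\<Sum>m\<in>Poly_Mapping.keys p. Poly_Mapping.single m (Poly_Mapping.lookup p m))"
    using assms(2) by (intro reducible_sum reducible_single[OF assms(1)]) (simp add: poly_ring_def)
  then show ?thesis by (simp add: poly_mapping_expand)
qed

section \<open>Independence of the standard monomials on the lines\<close>

lemma coeff_eval_mpoly:
  "coeff (eval_mpoly y p) k =
    (\<Sum>m\<in>Poly_Mapping.keys p. Poly_Mapping.lookup p m * coeff (eval_monomial y m) k)"
  by (simp add: eval_mpoly_def coeff_sum)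

lemma coeff_eval_mpoly_delta:
  assumes "\<And>m. m \<in> Poly_Mapping.keys p \<Longrightarrow> coeff (eval_monomial y m) k = (if m = m0 then d else 0)"
  shows "coeff (eval_mpoly y p) k = Poly_Mapping.lookup p m0 * d"
proof -
  have "coeff (eval_mpoly y p) k = (\<Sum>m\<in>Poly_Mapping.keys p. if m = m0 then Poly_Mapping.lookup p m0 * d else 0)"
    unfolding coeff_eval_mpoly by (rule sum.cong) (auto simp: assms)
  also have "\<dots> = Poly_Mapping.lookup p m0 * d"
    by (auto simp: in_keys_iff sum.delta')
  finally show ?thesis .
qed

lemma single_nat_eq_iff:
  fixes i j k l :: nat
  shows "Poly_Mapping.single i k = Poly_Mapping.single j l \<longleftrightarrow> k = l \<and> (k = 0 \<or> i = j)"
proof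
  assume eq: "Poly_Mapping.single i k = Poly_Mapping.single j l"
  then have "Poly_Mapping.lookup (Poly_Mapping.single i k) i = Poly_Mapping.lookup (Poly_Mapping.single j l) i"
    "Poly_Mapping.lookup (Poly_Mapping.single i k) j = Poly_Mapping.lookup (Poly_Mapping.single j l) j" by simp_all
  then show "k = l \<and> (k = 0 \<or> i = j)" by (auto simp: lookup_single when_def split: if_splits)
qed auto

lemma pair_eq_iff:
  fixes i j i' j' k k' :: nat
  assumes "i < j" "i' < j'" "1 \<le> k" "1 \<le> k'"
  shows "Poly_Mapping.single i k + Poly_Mapping.single j 1 = Poly_Mapping.single i' k' + Poly_Mapping.single j' 1
    \<longleftrightarrow> i = i' \<and> j = j' \<and> k = k'"
proof
  assume eq: "Poly_Mapping.single i k + Poly_Mapping.single j 1 = Poly_Mapping.single i' k' + Poly_Mapping.single j' 1"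
    (is "?m = ?m'")
  have "Poly_Mapping.keys ?m = {i, j}" "Poly_Mapping.keys ?m' = {i', j'}"
    using assms by (auto simp: keys_plus_nat)
  then have "{i, j} = {i', j'}" using eq by simp
  then have ij: "i = i'" "j = j'" using assms(1,2) by (auto simp: doubleton_eq_iff)
  moreover have "Poly_Mapping.lookup ?m i = Poly_Mapping.lookup ?m' i" using eq by simp
  ultimately show "i = i' \<and> j = j' \<and> k = k'" using assms(1) by (simp add: lookup_add lookup_single)
qed simp

lemma pair_neq_single:
  fixes i j k a l :: nat
  assumes "i < j" "1 \<le> k"
  shows "Poly_Mapping.single i k + Poly_Mapping.single j 1 \<noteq> Poly_Mapping.single a l"
proof
  assume eq: "Poly_Mapping.single i k + Poly_Mapping.single j 1 = Poly_Mapping.single a l"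
  have "Poly_Mapping.keys (Poly_Mapping.single i k + Poly_Mapping.single j 1) = {i, j}"
    using assms by (auto simp: keys_plus_nat)
  then have "{i, j} \<subseteq> {a}" unfolding eq by (metis keys_single empty_iff insertI1 order_refl)
  then show False using assms(1) by auto
qed

text \<open>The evaluations are triangular. On the line of i and n every standard monomial but the
  powers of x_i vanishes, since x_n never occurs and a mixed monomial has a variable other than x_i;
  this gives the pure coefficients. With those gone, only x_i^k x_j survives on the line of i and j
  < n, and the degree separates the values of k.\<close>

lemma standard_vanishing:
  assumes q: "Poly_Mapping.keys q \<subseteq> standard_monomials n"
    and vanish: "\<And>i j. i \<in> {1..n} \<Longrightarrow> j \<in> {1..n} \<Longrightarrow> i < j \<Longrightarrow> eval_mpoly (line i j) q = (0 :: 'k::field poly)"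
  shows "q = 0"
proof -
  have pure: "Poly_Mapping.lookup q (Poly_Mapping.single i k) = 0" if i: "i \<in> {1..<n}" for i k
  proof -
    have "coeff (eval_mpoly (line i n) q) k = Poly_Mapping.lookup q (Poly_Mapping.single i k) * 1"
    proof (rule coeff_eval_mpoly_delta)
      fix m assume "m \<in> Poly_Mapping.keys q"
      then have "m \<in> standard_monomials n" using q by blast
      then consider a l where "m = Poly_Mapping.single a l" "a \<in> {1..<n}"
        | a b l where "m = Poly_Mapping.single a l + Poly_Mapping.single b 1" "1 \<le> a" "a < b" "b < n" "1 \<le> l"
        unfolding standard_monomials_def by blast
      then show "coeff (eval_monomial (line i n :: nat \<Rightarrow> 'k poly) m) k = (if m = Poly_Mapping.single i k then 1 else 0)"
      proof cases
        case (1 a l)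
        then show ?thesis
          by (auto simp: line_def monom_power single_nat_eq_iff power_0_left)
      next
        case (2 a b l)
        then have "eval_monomial (line i n :: nat \<Rightarrow> 'k poly) m = 0"
          by (simp add: eval_monomial_add line_def)
        then show ?thesis using 2 pair_neq_single[of a b l i k] by simp
      qed
    qed
    then show ?thesis using vanish[of i n] i by simp
  qed
  have mixed: "Poly_Mapping.lookup q (Poly_Mapping.single i k + Poly_Mapping.single j 1) = 0"
    if ij: "1 \<le> i" "i < j" "j < n" "1 \<le> k" for i j k
  proof -
    \<comment> \<open>The monomial x_i^k x_j takes the value t^k (-t), which explains both the
      degree \<open>Suc k\<close> and the factor -1.\<close>
    have "coeff (eval_mpoly (line i j) q) (Suc k) =
        Poly_Mapping.lookup q (Poly_Mapping.single i k + Poly_Mapping.single j 1) * - 1"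
    proof (rule coeff_eval_mpoly_delta)
      fix m assume m: "m \<in> Poly_Mapping.keys q"
      then have "m \<in> standard_monomials n" using q by blast
      moreover have "m \<noteq> Poly_Mapping.single a l" if "a \<in> {1..<n}" for a l
        using pure[OF that, of l] m by (auto simp: in_keys_iff)
      ultimately obtain a b l where
        abl: "m = Poly_Mapping.single a l + Poly_Mapping.single b 1" "1 \<le> a" "a < b" "b < n" "1 \<le> l"
        unfolding standard_monomials_def by blast
      show "coeff (eval_monomial (line i j :: nat \<Rightarrow> 'k poly) m) (Suc k) =
        (if m = Poly_Mapping.single i k + Poly_Mapping.single j 1 then - 1 else 0)"
      proof (cases "a = i \<and> b = j")
        case True
        then have "eval_monomial (line i j :: nat \<Rightarrow> 'k poly) m = - monom 1 (Suc l)"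
          using abl ij by (simp add: eval_monomial_add line_def monom_power mult_monom)
        then show ?thesis using True abl ij pair_eq_iff[of a b i j l k] by simp
      next
        case False
        then have "a \<notin> {i, j} \<or> b \<notin> {i, j}" using abl(3) ij(2) by auto
        then have "eval_monomial (line i j :: nat \<Rightarrow> 'k poly) m = 0"
          using abl by (auto simp: eval_monomial_add line_def)
        then show ?thesis using False abl ij pair_eq_iff[of a b i j l k] by auto
      qed
    qed
    then show ?thesis using vanish[of i j] ij by simp
  qed
  have "Poly_Mapping.keys q = {}"
  proof (rule ccontr)
    assume "Poly_Mapping.keys q \<noteq> {}"
    then obtain m where m: "m \<in> Poly_Mapping.keys q" by blast
    then have "m \<in> standard_monomials n" using q by blast
    then have "Poly_Mapping.lookup q m = 0"
      unfolding standard_monomials_def using pure mixed by blast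
    then show False using m by (simp add: in_keys_iff)
  qed
  then show ?thesis by simp
qed

lemma eval_monomial_line_cubic:
  assumes "3 \<le> card (Poly_Mapping.keys m)"
  shows "eval_monomial (line i j :: nat \<Rightarrow> 'k::field poly) m = 0"
proof -
  have "\<not> Poly_Mapping.keys m \<subseteq> {i, j}"
  proof
    assume "Poly_Mapping.keys m \<subseteq> {i, j}"
    then have "card (Poly_Mapping.keys m) \<le> card {i, j}" by (intro card_mono) auto
    also have "\<dots> \<le> 2" using card_insert_le_m1[of 2 "{j}" i] by simp
    finally show False using assms by simp
  qed
  then obtain a where a: "a \<in> Poly_Mapping.keys m" "a \<notin> {i, j}" by blast
  then have "(line i j a :: 'k poly) ^ Poly_Mapping.lookup m a = 0"
    by (simp add: line_def zero_power_eq in_keys_iff)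
  then show ?thesis
    unfolding eval_monomial_def using a(1) by (intro prod_zero) auto
qed

lemma eval_line_lines_ideal:
  assumes "i \<in> {1..n}" "j \<in> {1..n}" "i < j" "p \<in> lines_ideal n"
  shows "eval_mpoly (line i j) p = (0 :: 'k::field poly)"
proof -
  obtain b s where p: "p = b + sum_vars n * s" "b \<in> cubic_ideal n"
    using assms(4) by (rule adjoinE)
  have "eval_mpoly (line i j) b = (0 :: 'k poly)"
    unfolding eval_mpoly_def using p(2)
    by (intro sum.neutral) (simp add: cubic_ideal_def mono_ideal_def eval_monomial_line_cubic)
  moreover have "eval_mpoly (line i j) (sum_vars n) = (0 :: 'k poly)"
  proof -
    have "(\<Sum>k\<in>{1..n}. line i j k :: 'k poly) = (\<Sum>k\<in>{i, j}. line i j k)"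
      using assms by (intro sum.mono_neutral_right) (auto simp: line_def)
    also have "\<dots> = 0" using assms(3) by (simp add: line_def)
    finally show ?thesis by (simp add: sum_vars_def eval_mpoly_sum)
  qed
  ultimately show ?thesis by (simp add: p eval_mpoly_add eval_mpoly_mult)
qed

text \<open>Modulo the ideal, \<open>p\<close> is a combination \<open>q\<close> of standard
  monomials; if \<open>p\<close> vanishes on all lines, so does \<open>q\<close>, and independence
  makes it 0. Consequently an element that vanishes on no line can be cancelled modulo this
  ideal.\<close>

lemma lines_ideal_iff:
  fixes p :: "'k::field mpoly"
  assumes "2 \<le> n" "p \<in> carrier (poly_ring n)"
  shows "p \<in> lines_ideal n \<longleftrightarrow>
    (\<forall>i\<in>{1..n}. \<forall>j\<in>{1..n}. i < j \<longrightarrow> eval_mpoly (line i j) p = 0)"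
proof
  show "p \<in> lines_ideal n" if vanish: "\<forall>i\<in>{1..n}. \<forall>j\<in>{1..n}. i < j \<longrightarrow> eval_mpoly (line i j) p = 0"
  proof -
    obtain q where q: "Poly_Mapping.keys q \<subseteq> standard_monomials n" "p - q \<in> lines_ideal n"
      using reducible_all[OF assms] unfolding reducible_def by blast
    have "q = 0"
    proof (rule standard_vanishing[OF q(1)])
      fix i j assume ij: "i \<in> {1..n}" "j \<in> {1..n}" "i < j"
      then show "eval_mpoly (line i j) q = 0"
        using eval_line_lines_ideal[OF ij q(2)] vanish by (simp add: eval_mpoly_diff)
    qed
    then show ?thesis using q(2) by simp
  qed
qed (blast intro: eval_line_lines_ideal)

text \<open>Only the product x_i x_j survives on its line, with the value -t^2, which is nonzero in
  every characteristic.\<close>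

lemma eval_line_sum_edges:
  assumes "i \<in> {1..n}" "j \<in> {1..n}" "i < j"
  shows "eval_mpoly (line i j) (sum_edges n) \<noteq> (0 :: 'k::field poly)"
proof -
  let ?P = "{(i, j). i \<in> {1..n} \<and> j \<in> {1..n} \<and> i < j}"
  have "finite ?P" by (rule finite_subset[of _ "{1..n} \<times> {1..n}"]) auto
  then have "(\<Sum>(a, b)\<in>?P. line i j a * line i j b :: 'k poly) = (\<Sum>(a, b)\<in>{(i, j)}. line i j a * line i j b)"
    using assms by (intro sum.mono_neutral_right) (auto simp: line_def split: if_splits)
  also have "\<dots> = - monom 1 2"
    using assms(3) by (simp add: line_def mult_monom numeral_2_eq_2)
  finally have "eval_mpoly (line i j) (sum_edges n) = (- monom 1 2 :: 'k poly)"
    by (simp add: sum_edges_def eval_mpoly_sum eval_mpoly_mult case_prod_unfold)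
  then show ?thesis by simp
qed

section \<open>Depth and dimension for three and four vertices\<close>

lemma depth_cubic_ideal_ge:
  assumes n: "2 \<le> n"
  shows "2 \<le> depth (poly_ring n Quot (cubic_ideal n :: 'k::field mpoly set))
    ((+>\<^bsub>poly_ring n\<^esub>) (cubic_ideal n) ` irrelevant_ideal n)"
proof -
  let ?I = "cubic_ideal n :: 'k mpoly set"
  let ?h = "(+>\<^bsub>poly_ring n\<^esub>) ?I"
  let ?e1 = "sum_vars n :: 'k mpoly" and ?e2 = "sum_edges n :: 'k mpoly"
  interpret S: cring "poly_ring n :: 'k mpoly ring" by (rule poly_ring_cring)
  have gen: "X ` {1..n} \<subseteq> (carrier (poly_ring n) :: 'k mpoly set)" using X_in_carrier by blast
  have irr: "ideal (irrelevant_ideal n) (poly_ring n :: 'k mpoly ring)"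
    unfolding irrelevant_ideal_def by (rule S.genideal_ideal[OF gen])
  have X: "(X i :: 'k mpoly) \<in> irrelevant_ideal n" if "i \<in> {1..n}" for i
    unfolding irrelevant_ideal_def using S.genideal_self[OF gen] that by blast
  have e1: "?e1 \<in> irrelevant_ideal n"
    unfolding sum_vars_def by (intro poly_ring_ideal_sum[OF irr] X)
  have e2: "?e2 \<in> irrelevant_ideal n"
    unfolding sum_edges_def
    by (intro poly_ring_ideal_sum[OF irr]) (auto intro!: poly_ring_idealD(4)[OF irr] X X_in_carrier)
  have carr: "set [?e1, ?e2] \<subseteq> carrier (poly_ring n)"
    using poly_ring_idealD(1)[OF irr] e1 e2 by auto
  have "y \<in> lines_ideal n" if y: "y \<in> carrier (poly_ring n)" "?e2 * y \<in> lines_ideal n" for y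
    unfolding lines_ideal_iff[OF n y(1)]
  proof (intro ballI impI)
    fix i j assume ij: "i \<in> {1..n}" "j \<in> {1..n}" "i < j"
    have "eval_mpoly (line i j) ?e2 * eval_mpoly (line i j) y = 0"
      using eval_line_lines_ideal[OF ij y(2)] by (simp add: eval_mpoly_mult)
    then show "eval_mpoly (line i j) y = 0" by (simp add: eval_line_sum_edges[OF ij])
  qed
  then have "regular_mod n ?I [?e1, ?e2]"
    by (simp add: sum_vars_cancel[OF n])
  \<comment> \<open>Properness: neither the cubic ideal nor the two symmetric polynomials contribute
    a constant term.\<close>
  moreover have "foldl (adjoin n) ?I [?e1, ?e2] \<subseteq> mono_ideal n (\<lambda>m. 1 \<le> total_degree n m)"
  proof (rule foldl_adjoin_least)
    show "ideal (mono_ideal n (\<lambda>m. 1 \<le> total_degree n m)) (poly_ring n)"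
      by (rule mono_ideal_ideal) (simp add: total_degree_add)
    show "set [?e1, ?e2] \<subseteq> mono_ideal n (\<lambda>m. 1 \<le> total_degree n m)"
      using e1 e2 irrelevant_ideal_subset by auto
    have "1 \<le> total_degree n m" if m: "Poly_Mapping.keys m \<subseteq> {1..n}" "3 \<le> card (Poly_Mapping.keys m)" for m
    proof -
      obtain i where i: "i \<in> Poly_Mapping.keys m" using m(2) by fastforce
      then have "1 \<le> Poly_Mapping.lookup m i" by (simp add: in_keys_iff)
      also have "\<dots> \<le> total_degree n m"
        unfolding total_degree_def using i m(1) by (intro member_le_sum) auto
      finally show ?thesis .
    qed
    then show "?I \<subseteq> mono_ideal n (\<lambda>m. 1 \<le> total_degree n m)"
      by (auto simp: cubic_ideal_def mono_ideal_def poly_ring_def)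
  qed
  then have "1 \<notin> foldl (adjoin n) ?I [?e1, ?e2]"
    by (auto simp: mono_ideal_def total_degree_def)
  ultimately have "regular_sequence (poly_ring n Quot ?I) (map ?h [?e1, ?e2])"
    using regular_sequence_Quot_iff[OF cubic_ideal_ideal carr] by blast
  moreover have "set (map ?h [?e1, ?e2]) \<subseteq> ?h ` irrelevant_ideal n" using e1 e2 by simp
  moreover have "(2 :: enat) = enat (length (map ?h [?e1, ?e2]))" by (simp add: numeral_eq_enat)
  ultimately show ?thesis unfolding depth_def by (intro Sup_upper) blast
qed

text \<open>For a < b < c within 1, ..., 4 both gaps are at most 2, so \<open>b\<close> is adjacent
  to \<open>a\<close> and to \<open>c\<close>. At five vertices this breaks down, for instance at
  {1, 2, 5}.\<close>

lemma path_square_cubic: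
  assumes "n = 3 \<or> n = 4"
  shows "(path3_ideal n (path_square n) :: 'k::field mpoly set) = cubic_ideal n"
proof -
  have "has_path3 (path_square n) U \<longleftrightarrow> 3 \<le> card U" if U: "U \<subseteq> {1..n}" for U
  proof
    have fin: "finite U" using U finite_subset by blast
    assume "has_path3 (path_square n) U"
    then obtain a b c where abc: "{a, b, c} \<subseteq> U" "a \<noteq> b" "b \<noteq> c" "a \<noteq> c" unfolding has_path3_def by blast
    have "3 = card {a, b, c}" using abc by simp
    also have "\<dots> \<le> card U" by (rule card_mono[OF fin abc(1)])
    finally show "3 \<le> card U" .
  next
    assume "3 \<le> card U"
    then obtain V where V: "V \<subseteq> U" "card V = 3" using obtain_subset_with_card_n by metis
    then obtain a b c where abc: "V = {a, b, c}" "a < b" "b < c"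
      by (metis card_3_iff insert_commute linorder_neqE_nat)
    have "a \<in> {1..4}" "b \<in> {1..4}" "c \<in> {1..4}" using V U abc assms by auto
    moreover have "a \<in> {1..n}" "b \<in> {1..n}" "c \<in> {1..n}" using V U abc by auto
    ultimately have "{a, b} \<in> path_square n" "{b, c} \<in> path_square n"
      using abc(2,3) by (auto simp: path_square_edge_iff)
    then show "has_path3 (path_square n) U"
      unfolding has_path3_def using V(1) abc
      by (intro bexI[of _ a] bexI[of _ b] bexI[of _ c]) auto
  qed
  then show ?thesis
    unfolding path3_ideal_eq_mono_ideal cubic_ideal_def mono_ideal_def poly_ring_def by auto
qed

text \<open>A prime above the cubic ideal contains a factor of each product of three distinct
  variables, so it cannot miss three variables.\<close>

lemma krull_dim_cubic_ideal_le:
  "krull_dim (poly_ring n Quot (cubic_ideal n :: 'k::field mpoly set)) \<le> 2"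
proof -
  have "krull_dim (poly_ring n Quot (cubic_ideal n :: 'k mpoly set)) \<le> enat 2"
  proof (rule krull_dim_Quot_le[OF cubic_ideal_ideal])
    fix Q :: "'k mpoly set" assume Q: "primeideal Q (poly_ring n)" "cubic_ideal n \<subseteq> Q"
    show "card {i\<in>{1..n}. X i \<notin> Q} \<le> 2"
    proof (rule ccontr)
      assume "\<not> card {i\<in>{1..n}. X i \<notin> Q} \<le> 2"
      then obtain V where V: "V \<subseteq> {i\<in>{1..n}. X i \<notin> Q}" "card V = 3"
        using obtain_subset_with_card_n[of 3 "{i\<in>{1..n}. X i \<notin> Q}"] by auto
      then obtain a b c where abc: "V = {a, b, c}" "a \<noteq> b" "b \<noteq> c" "a \<noteq> c" by (auto simp: card_3_iff)
      let ?m = "Poly_Mapping.single a 1 + Poly_Mapping.single b 1 + Poly_Mapping.single c (1 :: nat)"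
      have keys: "Poly_Mapping.keys ?m = V" by (auto simp: keys_plus_nat abc(1))
      have "X a * X b * X c = Poly_Mapping.single ?m (1 :: 'k)" by (simp add: X_def mult_single)
      also have "\<dots> \<in> Q"
      proof (rule subsetD[OF Q(2)], rule single_cubic)
        show "Poly_Mapping.keys ?m \<subseteq> {1..n}" "3 \<le> card (Poly_Mapping.keys ?m)"
          unfolding keys using V by auto
      qed
      finally have "X a * X b * X c \<in> Q" .
      moreover have carr: "(X i :: 'k mpoly) \<in> carrier (poly_ring n)" if "i \<in> V" for i
        using V(1) that by (intro X_in_carrier) blast
      ultimately have "X a \<in> Q \<or> X b \<in> Q \<or> X c \<in> Q"
        using primeideal.I_prime[OF Q(1), of "X a * X b" "X c"] primeideal.I_prime[OF Q(1), of "X a" "X b"]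
          poly_ring_closed(2)[of "X a" n "X b"] abc(1) by auto
      then show False using V(1) abc(1) by auto
    qed
  qed
  then show ?thesis by (simp add: numeral_eq_enat)
qed

text \<open>The range starts at 3: for two vertices the ideal is zero by
  \<open>path3_ideal_two\<close>, and the polynomial ring in two variables is Cohen-Macaulay
  although 2 is neither 3 nor 4.\<close>

theorem theorem2p7:
  fixes n :: nat
  assumes "n \<ge> 3"
  shows "cohen_macaulay_quotient n (path3_ideal n (path_square n) :: 'k::field mpoly set)
           \<longleftrightarrow> n = 3 \<or> n = 4"
proof
  assume "cohen_macaulay_quotient n (path3_ideal n (path_square n) :: 'k mpoly set)"
  then have "\<not> 5 \<le> n" using not_cohen_macaulay_path_square by blast
  then show "n = 3 \<or> n = 4" using assms by linarith
next
  assume n: "n = 3 \<or> n = 4"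
  let ?E = "path_square n"
  let ?I = "path3_ideal n ?E :: 'k mpoly set"
  let ?depth = "depth (poly_ring n Quot ?I) ((+>\<^bsub>poly_ring n\<^esub>) ?I ` irrelevant_ideal n)"
  \<comment> \<open>The same set serves twice: as a facet it bounds the depth from above, as a face
    it bounds the dimension from below.\<close>
  have F: "{1, 2} \<subseteq> {1..n}" "\<not> has_path3 ?E {1, 2}" "card {1, 2 :: nat} = 2"
    using assms by (auto simp: has_path3_def)
  have facet: "has_path3 ?E (insert i {1, 2})" if i: "i \<in> {1..n} - {1, 2}" for i
  proof -
    have "{1, 2} \<in> ?E" "{2, i} \<in> ?E" using i n by (auto simp: path_square_edge_iff)
    then show ?thesis
      unfolding has_path3_def using i by (intro bexI[of _ 1] bexI[of _ 2] bexI[of _ i]) auto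
  qed
  have "?depth \<le> enat (card {1, 2 :: nat})"
    by (rule depth_path3_ideal_le[OF F(1,2) facet])
  then have "?depth \<le> 2" by (simp only: F(3) numeral_eq_enat)
  moreover have "enat (card {1, 2 :: nat}) \<le> krull_dim (poly_ring n Quot ?I)"
    by (rule krull_dim_path3_ideal_ge[OF F(1,2)])
  then have "2 \<le> krull_dim (poly_ring n Quot ?I)" by (simp only: F(3) numeral_eq_enat)
  moreover have "2 \<le> ?depth"
    unfolding path_square_cubic[OF n] using assms by (intro depth_cubic_ideal_ge) simp
  moreover have "krull_dim (poly_ring n Quot ?I) \<le> 2"
    unfolding path_square_cubic[OF n] by (rule krull_dim_cubic_ideal_le)
  ultimately have "?depth = krull_dim (poly_ring n Quot ?I)" by simp
  then show "cohen_macaulay_quotient n ?I" by (simp add: cohen_macaulay_quotient_def Let_def)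
qed

end
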